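(* Let $n\geq 9$. Goursat structures on $n$-manifolds are not weakly determined by abnormal curves of their derived flags. That is, there exist two Goursat structures $\mathcal{D}$ and $\tilde{\mathcal{D}}$ on $n$-manifolds and a local diffeomorphism $\varphi$, with $\varphi(p)=\tilde p$, that for each $i\ge0$ transforms each abnormal curve of $\mathcal{D}^{(i)}$ into an abnormal curve of $\tilde{\mathcal{D}}^{(i)}$, and the other way around, although $\mathcal{D}$ at $p$ and $\tilde{\mathcal{D}}$ at $\tilde p$ are not locally equivalent.
   Context: All objects are smooth unless stated otherwise. The derived flag of a distribution is $\mathcal{D}^{(0)}=\mathcal{D}$, $\mathcal{D}^{(i+1)}=\mathcal{D}^{(i)}+[\mathcal{D}^{(i)},\mathcal{D}^{(i)}]$. A Goursat structure on a manifold of dimension $n\geq 3$ is a rank two distribution with $\dim\mathcal{D}^{(i)}(p)=i+2$ for $0\le i\le n-2$ and every $p$. Distributions $\mathcal{D}$ at $p$ and $\tilde{\mathcal{D}}$ at $\tilde p$ are locally equivalent if there is a diffeomorphism $\varphi$ between neighborhoods of $p$ and $\tilde p$ with $\varphi(p)=\tilde p$ and $\varphi_*\mathcal{D}=\tilde{\mathcal{D}}$. Distributions of a class $\mathcal{Q}$ are weakly determined by abnormal curves of their derived flags if, for any pair $\mathcal{D},\tilde{\mathcal{D}}$ in $\mathcal{Q}$, the existence of a local diffeomorphism that transforms each abnormal curve of $\mathcal{D}^{(i)}$ into an abnormal curve of $\tilde{\mathcal{D}}^{(i)}$, and the other way around, for each $i\ge0$, implies the local equivalence of $\mathcal{D}$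 and $\tilde{\mathcal{D}}$. Abnormal curves: an integral curve of a rank $k$ distribution is an absolutely continuous curve $x:I\to M$ tangent to it for almost all $t$ in the interval $I$. In a local chart with the distribution spanned by $f_1,\dots,f_k$, write $\dot x=\sum_i f_i(x)u_i$ with measurable controls $u$, and $H(x,p,u)=\langle p,\sum_i f_i(x)u_i\rangle$. The curve is abnormal if there is an absolutely continuous lift $(x(t),p(t))$ to $T^*M$ with $p(t)\ne0$ for every $t$, such that almost everywhere $\dot x=\partial H/\partial p$, $\dot p=-\partial H/\partial x$, $\partial H/\partial u=0$. *)

theory Defs
  imports "HOL-Analysis.Analysis"
begin

section \<open>Smooth functions on open sets\<close>

text \<open>Only meaningful on open sets: the derivatives are taken in the full space.\<close>

primrec C_on :: "nat \<Rightarrow> 'a::euclidean_space set \<Rightarrow> ('a \<Rightarrow> 'b::real_normed_vector) \<Rightarrow> bool" where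
  "C_on 0 S f \<longleftrightarrow> continuous_on S f"
| "C_on (Suc k) S f \<longleftrightarrow> (\<forall>x\<in>S. f differentiable (at x)) \<and>
     (\<forall>v. C_on k S (\<lambda>x. frechet_derivative f (at x) v))"

definition smooth_on :: "'a::euclidean_space set \<Rightarrow> ('a \<Rightarrow> 'b::real_normed_vector) \<Rightarrow> bool" where
  "smooth_on S f \<longleftrightarrow> (\<forall>k. C_on k S f)"


section \<open>Smooth manifolds\<close>

text \<open>
  A manifold is an abstract topological space with a (not necessarily maximal) smooth atlas. A
  chart \<open>(V, c)\<close> consists of its domain and its coordinate map; the values of \<open>c\<close> outside \<open>V\<close>
  are irrelevant. The dimension is \<open>CARD('n)\<close>.
\<close>

type_synonym ('m, 'n) chart = "'m set \<times> ('m \<Rightarrow> real^'n)"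

record ('m, 'n::finite) manifold =
  mtop :: "'m topology"
  atlas :: "('m, 'n) chart set"

definition coord_rep ::
  "('m, 'n::finite) chart \<Rightarrow> ('k, 'l::finite) chart \<Rightarrow> ('m \<Rightarrow> 'k) \<Rightarrow> real^'n \<Rightarrow> real^'l" where
  "coord_rep C C' \<phi> = snd C' \<circ> \<phi> \<circ> inv_into (fst C) (snd C)"

text \<open>The differential of \<open>\<phi>\<close> at the point \<open>x\<close> in the coordinates \<open>C\<close> and \<open>C'\<close>.\<close>

definition coord_diff ::
  "('m, 'n::finite) chart \<Rightarrow> ('k, 'l::finite) chart \<Rightarrow> ('m \<Rightarrow> 'k) \<Rightarrow> 'm \<Rightarrow> real^'n \<Rightarrow> real^'l" where
  "coord_diff C C' \<phi> x = frechet_derivative (coord_rep C C' \<phi>) (at (snd C x))"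

definition smooth_map ::
  "('m, 'n::finite) manifold \<Rightarrow> ('k, 'l::finite) manifold \<Rightarrow> 'm set \<Rightarrow> ('m \<Rightarrow> 'k) \<Rightarrow> bool" where
  "smooth_map M M' U \<phi> \<longleftrightarrow> (\<forall>C\<in>atlas M. \<forall>C'\<in>atlas M'.
     smooth_on (snd C ` {x \<in> U. x \<in> fst C \<and> \<phi> x \<in> fst C'}) (coord_rep C C' \<phi>))"

text \<open>The last condition says that the transition maps of the atlas are smooth.\<close>

definition smooth_manifold :: "('m, 'n::finite) manifold \<Rightarrow> bool" where
  "smooth_manifold M \<longleftrightarrow>
     Hausdorff_space (mtop M) \<and> second_countable (mtop M) \<and>
     (\<forall>C\<in>atlas M. openin (mtop M) (fst C) \<and> open (snd C ` fst C) \<and>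
        homeomorphic_map (subtopology (mtop M) (fst C)) (top_of_set (snd C ` fst C)) (snd C)) \<and>
     (\<Union>C\<in>atlas M. fst C) = topspace (mtop M) \<and>
     smooth_map M M (topspace (mtop M)) id"

definition local_diffeo ::
  "('m, 'n::finite) manifold \<Rightarrow> ('k, 'n) manifold \<Rightarrow> 'm set \<Rightarrow> 'k set \<Rightarrow> ('m \<Rightarrow> 'k) \<Rightarrow> bool" where
  "local_diffeo M M' U U' \<phi> \<longleftrightarrow>
     openin (mtop M) U \<and> openin (mtop M') U' \<and>
     homeomorphic_map (subtopology (mtop M) U) (subtopology (mtop M') U') \<phi> \<and>
     smooth_map M M' U \<phi> \<and> smooth_map M' M U' (inv_into U \<phi>)"


section \<open>Distributions\<close>

text \<open>
  \<open>local_frame E V k f\<close>: on the open set \<open>V\<close> of coordinate space, the smooth vector fields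
  \<open>f 0, \<dots>, f (k - 1)\<close> form a frame of \<open>E\<close> (the dimension forces linear independence).
\<close>

definition local_frame ::
  "(real^'n \<Rightarrow> (real^'n) set) \<Rightarrow> (real^'n) set \<Rightarrow> nat \<Rightarrow> (nat \<Rightarrow> real^'n \<Rightarrow> real^'n) \<Rightarrow> bool" where
  "local_frame E V k f \<longleftrightarrow> open V \<and> (\<forall>i<k. smooth_on V (f i)) \<and>
     (\<forall>x\<in>V. E x = span ((\<lambda>i. f i x) ` {..<k}) \<and> dim (E x) = k)"

text \<open>
  A tangent vector of a manifold is given by its components in the charts. Accordingly, a
  distribution \<open>D\<close> assigns to every chart \<open>C\<close> of the atlas and every point of coordinate space a
  set of component vectors; only the values \<open>D C y\<close> with \<open>y \<in> snd C ` fst C\<close> matter.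
  \<open>pushes_forward M M' U \<phi> D D'\<close> says that the differential of \<open>\<phi>\<close> carries \<open>D\<close> to \<open>D'\<close> over \<open>U\<close>;
  for \<open>\<phi> = id\<close> and \<open>D' = D\<close> this is the compatibility of the components under changes of chart.
\<close>

type_synonym ('m, 'n) distr = "('m, 'n) chart \<Rightarrow> real^'n \<Rightarrow> (real^'n) set"

definition pushes_forward ::
  "('m, 'n::finite) manifold \<Rightarrow> ('k, 'n) manifold \<Rightarrow> 'm set \<Rightarrow> ('m \<Rightarrow> 'k) \<Rightarrow>
   ('m, 'n) distr \<Rightarrow> ('k, 'n) distr \<Rightarrow> bool" where
  "pushes_forward M M' U \<phi> D D' \<longleftrightarrow> (\<forall>C\<in>atlas M. \<forall>C'\<in>atlas M'. \<forall>x\<in>U.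
     x \<in> fst C \<longrightarrow> \<phi> x \<in> fst C' \<longrightarrow>
     D' C' (snd C' (\<phi> x)) = coord_diff C C' \<phi> x ` D C (snd C x))"

definition distribution :: "('m, 'n::finite) manifold \<Rightarrow> nat \<Rightarrow> ('m, 'n) distr \<Rightarrow> bool" where
  "distribution M k D \<longleftrightarrow>
     (\<forall>C\<in>atlas M. \<forall>y\<in>snd C ` fst C. \<exists>V f. y \<in> V \<and> V \<subseteq> snd C ` fst C \<and> local_frame (D C) V k f) \<and>
     pushes_forward M M (topspace (mtop M)) id D D"

definition lie_bracket ::
  "(real^'n \<Rightarrow> real^'n) \<Rightarrow> (real^'n \<Rightarrow> real^'n) \<Rightarrow> real^'n \<Rightarrow> real^'n" where
  "lie_bracket X Y x = frechet_derivative Y (at x) (X x) - frechet_derivative X (at x) (Y x)"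

text \<open>
  \<open>E + [E, E]\<close> on the open set \<open>W\<close> of coordinate space, spanned pointwise by \<open>E\<close> and the brackets of
  its local smooth sections. For the Goursat structures below all members of the flag have constant
  rank, so that this pointwise description agrees with the one by sheaves of sections.
\<close>

definition derived_on ::
  "(real^'n) set \<Rightarrow> (real^'n \<Rightarrow> (real^'n) set) \<Rightarrow> real^'n \<Rightarrow> (real^'n) set" where
  "derived_on W E x = span (E x \<union>
     {lie_bracket X Y x | X Y V. open V \<and> x \<in> V \<and> V \<subseteq> W \<and> smooth_on V X \<and> smooth_on V Y \<and>
        (\<forall>y\<in>V. X y \<in> E y \<and> Y y \<in> E y)})"

definition derived_flag :: "('m, 'n::finite) distr \<Rightarrow> nat \<Rightarrow> ('m, 'n) distr" where
  "derived_flag D i = (\<lambda>C. (derived_on (snd C ` fst C) ^^ i) (D C))"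

definition goursat :: "('m, 'n::finite) manifold \<Rightarrow> ('m, 'n) distr \<Rightarrow> bool" where
  "goursat M D \<longleftrightarrow>
     3 \<le> CARD('n) \<and> smooth_manifold M \<and> distribution M 2 D \<and>
     (\<forall>i\<le>CARD('n) - 2. \<forall>C\<in>atlas M. \<forall>y\<in>snd C ` fst C. dim (derived_flag D i C y) = i + 2)"

definition locally_equivalent ::
  "('m, 'n::finite) manifold \<Rightarrow> ('m, 'n) distr \<Rightarrow> 'm \<Rightarrow>
   ('k, 'n) manifold \<Rightarrow> ('k, 'n) distr \<Rightarrow> 'k \<Rightarrow> bool" where
  "locally_equivalent M D p M' D' p' \<longleftrightarrow>
     (\<exists>U U' \<phi>. local_diffeo M M' U U' \<phi> \<and> p \<in> U \<and> \<phi> p = p' \<and> pushes_forward M M' U \<phi> D D')"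


section \<open>Abnormal curves\<close>

definition abs_cont :: "real \<Rightarrow> real \<Rightarrow> (real \<Rightarrow> 'a::metric_space) \<Rightarrow> bool" where
  "abs_cont a b x \<longleftrightarrow> (\<forall>\<epsilon>>0. \<exists>\<delta>>0. \<forall>P. finite P \<longrightarrow>
     (\<forall>(s, t)\<in>P. a \<le> s \<and> s \<le> t \<and> t \<le> b) \<longrightarrow>
     pairwise (\<lambda>(s, t) (s', t'). {s<..<t} \<inter> {s'<..<t'} = {}) P \<longrightarrow>
     (\<Sum>(s, t)\<in>P. t - s) < \<delta> \<longrightarrow> (\<Sum>(s, t)\<in>P. dist (x s) (x t)) < \<epsilon>)"

text \<open>
  Components \<open>z C\<close> along a curve \<open>\<gamma>\<close> on \<open>I\<close>: absolute continuity on all compact subintervals of \<open>I\<close>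
  that are mapped into the chart domain.
\<close>

definition abs_cont_comps ::
  "('m, 'n::finite) manifold \<Rightarrow> real set \<Rightarrow> (real \<Rightarrow> 'm) \<Rightarrow>
   (('m, 'n) chart \<Rightarrow> real \<Rightarrow> real^'n) \<Rightarrow> bool" where
  "abs_cont_comps M I \<gamma> z \<longleftrightarrow>
     (\<forall>C\<in>atlas M. \<forall>a b. a \<le> b \<longrightarrow> {a..b} \<subseteq> I \<longrightarrow> \<gamma> ` {a..b} \<subseteq> fst C \<longrightarrow> abs_cont a b (z C))"

definition abs_cont_curve ::
  "('m, 'n::finite) manifold \<Rightarrow> real set \<Rightarrow> (real \<Rightarrow> 'm) \<Rightarrow> bool" where
  "abs_cont_curve M I \<gamma> \<longleftrightarrow>
     continuous_map (top_of_set I) (mtop M) \<gamma> \<and> abs_cont_comps M I \<gamma> (\<lambda>C. snd C \<circ> \<gamma>)"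

definition hamiltonian ::
  "nat \<Rightarrow> (nat \<Rightarrow> real^'n \<Rightarrow> real^'n) \<Rightarrow> real^'n \<Rightarrow> real^'n \<Rightarrow> (nat \<Rightarrow> real) \<Rightarrow> real" where
  "hamiltonian k f x p u = p \<bullet> (\<Sum>i<k. u i *\<^sub>R f i x)"

definition hamilton_eqs ::
  "nat \<Rightarrow> (nat \<Rightarrow> real^'n \<Rightarrow> real^'n) \<Rightarrow> real set \<Rightarrow>
   (real \<Rightarrow> real^'n) \<Rightarrow> (real \<Rightarrow> real^'n) \<Rightarrow> (real \<Rightarrow> nat \<Rightarrow> real) \<Rightarrow> bool" where
  "hamilton_eqs k f J x p u \<longleftrightarrow> (AE t in lebesgue. t \<in> J \<longrightarrow> (\<exists>x' p'.
     (x has_vector_derivative x') (at t within J) \<and>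
     (p has_vector_derivative p') (at t within J) \<and>
     GDERIV (\<lambda>q. hamiltonian k f (x t) q (u t)) (p t) :> x' \<and>
     GDERIV (\<lambda>y. hamiltonian k f y (p t) (u t)) (x t) :> - p' \<and>
     (\<forall>j<k. ((\<lambda>s. hamiltonian k f (x t) (p t) ((u t)(j := s))) has_real_derivative 0)
        (at (u t j)))))"

text \<open>
  A covector along \<open>\<gamma>\<close> is given by its components \<open>p C t\<close> in the charts, which are paired with
  vector components by the inner product; hence the first condition below. The frames of the
  distribution \<open>E\<close> exist only locally, so the Hamilton equations are required near every parameter \<open>t0\<close> in
  some chart and some frame; the lift \<open>p\<close> is global. The condition does not depend on the choice
  of chart and frame.
\<close>

definition abnormal_lift ::
  "('m, 'n::finite) manifold \<Rightarrow> ('m, 'n) distr \<Rightarrow> real set \<Rightarrow> (real \<Rightarrow> 'm) \<Rightarrow>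
   (('m, 'n) chart \<Rightarrow> real \<Rightarrow> real^'n) \<Rightarrow> bool" where
  "abnormal_lift M E I \<gamma> p \<longleftrightarrow>
     (\<forall>t\<in>I. \<forall>C\<in>atlas M. \<forall>C'\<in>atlas M. \<gamma> t \<in> fst C \<longrightarrow> \<gamma> t \<in> fst C' \<longrightarrow>
        (\<forall>v. p C t \<bullet> v = p C' t \<bullet> coord_diff C C' id (\<gamma> t) v)) \<and>
     (\<forall>t\<in>I. \<forall>C\<in>atlas M. \<gamma> t \<in> fst C \<longrightarrow> p C t \<noteq> 0) \<and>
     abs_cont_comps M I \<gamma> p \<and>
     (\<forall>t0\<in>I. \<exists>C\<in>atlas M. \<exists>V k f r u.
        V \<subseteq> snd C ` fst C \<and> local_frame (E C) V k f \<and> 0 < r \<and>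
        (\<forall>t \<in> I \<inter> ball t0 r. \<gamma> t \<in> fst C \<and> snd C (\<gamma> t) \<in> V) \<and>
        (\<forall>i<k. (\<lambda>t. u t i) \<in> borel_measurable (lebesgue_on (I \<inter> ball t0 r))) \<and>
        hamilton_eqs k f (I \<inter> ball t0 r) (snd C \<circ> \<gamma>) (p C) u)"

definition abnormal_curve ::
  "('m, 'n::finite) manifold \<Rightarrow> ('m, 'n) distr \<Rightarrow> real set \<Rightarrow> (real \<Rightarrow> 'm) \<Rightarrow> bool" where
  "abnormal_curve M E I \<gamma> \<longleftrightarrow> is_interval I \<and> interior I \<noteq> {} \<and> abs_cont_curve M I \<gamma> \<and>
     (\<exists>p. abnormal_lift M E I \<gamma> p)"


section \<open>Weak determination by abnormal curves of the derived flag\<close>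

definition transforms_abnormal_curves ::
  "('m, 'n::finite) manifold \<Rightarrow> ('m, 'n) distr \<Rightarrow> ('k, 'n) manifold \<Rightarrow> ('k, 'n) distr \<Rightarrow>
   'm set \<Rightarrow> 'k set \<Rightarrow> ('m \<Rightarrow> 'k) \<Rightarrow> bool" where
  "transforms_abnormal_curves M D M' D' U U' \<phi> \<longleftrightarrow> (\<forall>i.
     (\<forall>I \<gamma>. \<gamma> ` I \<subseteq> U \<longrightarrow> abnormal_curve M (derived_flag D i) I \<gamma> \<longrightarrow>
        abnormal_curve M' (derived_flag D' i) I (\<phi> \<circ> \<gamma>)) \<and>
     (\<forall>I \<gamma>. \<gamma> ` I \<subseteq> U' \<longrightarrow> abnormal_curve M' (derived_flag D' i) I \<gamma> \<longrightarrow>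
        abnormal_curve M (derived_flag D i) I (inv_into U \<phi> \<circ> \<gamma>)))"

definition weakly_determined ::
  "(('m, 'n::finite) manifold \<Rightarrow> ('m, 'n) distr \<Rightarrow> bool) \<Rightarrow> bool" where
  "weakly_determined Q \<longleftrightarrow> (\<forall>M D M' D' U U' \<phi> p.
     Q M D \<longrightarrow> Q M' D' \<longrightarrow> local_diffeo M M' U U' \<phi> \<longrightarrow> p \<in> U \<longrightarrow>
     transforms_abnormal_curves M D M' D' U U' \<phi> \<longrightarrow>
     locally_equivalent M D p M' D' (\<phi> p))"

end

theory Submission
  imports Defs
begin

text \<open>
  Both structures are one and the same distribution on the whole coordinate space, seen at two
  points. Write \<open>z0, z1, ...\<close> for the coordinates. Think of a plane curve with \<open>x = z4\<close>, \<open>y =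
  z0\<close> and with \<open>z1, z2, z3\<close> the first three derivatives of \<open>y\<close> with respect to \<open>x\<close>. From then on
  \<open>r = z3\<close> is taken as the independent variable, and \<open>z5, z6, ...\<close> are the successive
  derivatives of \<open>x\<close> with respect to \<open>r\<close>. The corresponding contact forms \<open>form 0\<close>, \<open>form 1\<close>,
  ... are all of the shape \<open>dz a - z b dz c\<close>, and \<open>flag N\<close> is the common kernel of the first \<open>N\<close>
  of them. The structure equations give \<open>flag N + [flag N, flag N] = flag (N - 1)\<close>
  (\<open>derived_on_flag\<close>), so that \<open>flag (n - 2)\<close> is a Goursat structure whose derived flag consists
  of the other \<open>flag N\<close>.

  At a point with \<open>z7 = 1\<close> at which all of \<open>z0, ..., z6\<close> are zero, the curve is \<open>x = r^3/6 + c
  r^4/24 + ...\<close> with \<open>c = z8\<close>. The two points of the theorem have \<open>c = 0\<close> and \<open>c = 1\<close>, and the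
  local diffeomorphism is the translation of \<open>z8\<close> by \<open>1\<close> on the half space \<open>z7 > 0\<close>.

  The translation preserves abnormal curves. The coefficients of the forms before \<open>form 6\<close> do
  not depend on \<open>z8\<close>, so \<open>flag N\<close> is invariant for \<open>N \<le> 6\<close>. For \<open>N \<ge> 7\<close> the abnormal curves of
  \<open>flag N\<close> in the half space are exactly the curves along which only the coordinates \<open>z k\<close> with
  \<open>k > N\<close> vary, a condition that is invariant as well: where the velocity of \<open>z3\<close> is nonzero,
  the adjoint equation makes the components of the covector vanish one after the other until
  either the covector is zero or \<open>z5 = z6 = z7 = 0\<close> (\<open>abnormal_velocity_3_zero\<close>); conversely
  \<open>dz0 - z1 dz4\<close> is a lift of every such curve (\<open>covector_lift_shift_vertical\<close>).

  The two points are not equivalent. A local equivalence preserves every \<open>flag N\<close>, hence also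
  its Cauchy characteristics, so that its component \<open>x\<close> is a function of \<open>z0, z1, z4\<close> and its
  component \<open>z2\<close> a function of \<open>z0, z1, z2, z4\<close>. Along the integral curve through the point with
  \<open>c = 0\<close> the functions \<open>z4, z2, z1, z0\<close> of \<open>r\<close> have orders \<open>3, 4, 7, 10\<close>. Therefore on the
  image curve \<open>x\<close> has no terms of order \<open>4\<close> and \<open>5\<close>, and \<open>z2\<close> has no term of order \<open>5\<close>. The
  relation \<open>dz2 = r dx\<close> turns this into \<open>r = a s + O(s^3)\<close>, hence \<open>x = b r^3 + O(r^5)\<close>, and the
  image point has \<open>c = 0\<close> (\<open>no_equivalence\<close>).
\<close>


section \<open>Smooth functions\<close>

lemma C_on_subset: "C_on k S f \<Longrightarrow> T \<subseteq> S \<Longrightarrow> C_on k T f"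
  by (induction k arbitrary: f) (auto intro: continuous_on_subset)

lemma C_on_cong:
  assumes "open S" "\<And>x. x \<in> S \<Longrightarrow> f x = g x" "C_on k S f"
  shows "C_on k S g"
  using assms(2,3)
proof (induction k arbitrary: f g)
  case 0
  then show ?case by (simp cong: continuous_on_cong)
next
  case (Suc k)
  have d: "(g has_derivative frechet_derivative f (at x)) (at x)" if "x \<in> S" for x
    using Suc.prems that assms(1)
    by (auto simp: frechet_derivative_works intro: has_derivative_transform_within_open[of f _ x UNIV S])
  have e: "frechet_derivative g (at x) = frechet_derivative f (at x)" if "x \<in> S" for x
    using frechet_derivative_at[OF d[OF that]] by simp
  then have "C_on k S (\<lambda>x. frechet_derivative g (at x) v)" for v
    using Suc.IH[of "\<lambda>x. frechet_derivative f (at x) v" "\<lambda>x. frechet_derivative g (at x) v"] Suc.prems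
    by simp
  with d show ?case by (auto simp: differentiable_def)
qed

lemma C_on_Suc_imp: "C_on (Suc k) S f \<Longrightarrow> C_on k S f"
proof (induction k arbitrary: f)
  case 0
  then show ?case
    by (auto intro!: continuous_at_imp_continuous_on differentiable_imp_continuous_within)
next
  case (Suc k)
  then show ?case by (metis C_on.simps(2))
qed

lemma C_on_const: "C_on k S (\<lambda>x. c)"
proof (induction k arbitrary: c)
  case (Suc k)
  have "frechet_derivative (\<lambda>x. c) (at x) = (\<lambda>v. 0)" for x :: 'a
    by (rule frechet_derivative_at[symmetric]) (rule has_derivative_const)
  then show ?case using Suc by simp
qed simp

lemma C_on_add:
  assumes "open S" "C_on k S f" "C_on k S g" shows "C_on k S (\<lambda>x. f x + g x)"
  using assms(2,3)
proof (induction k arbitrary: f g)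
  case 0
  then show ?case by (auto intro: continuous_intros)
next
  case (Suc k)
  have d: "((\<lambda>x. f x + g x) has_derivative
      (\<lambda>v. frechet_derivative f (at x) v + frechet_derivative g (at x) v)) (at x)" if "x \<in> S" for x
    using Suc.prems that by (auto simp: frechet_derivative_works intro!: has_derivative_add)
  have e: "frechet_derivative f (at x) v + frechet_derivative g (at x) v
      = frechet_derivative (\<lambda>x. f x + g x) (at x) v" if "x \<in> S" for x v
    using fun_cong[OF frechet_derivative_at[OF d[OF that]], of v] .
  have "C_on k S (\<lambda>x. frechet_derivative (\<lambda>x. f x + g x) (at x) v)" for v
  proof (rule C_on_cong[OF assms(1)])
    show "C_on k S (\<lambda>x. frechet_derivative f (at x) v + frechet_derivative g (at x) v)" using Suc.prems by (intro Suc.IH) simp_all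
  qed (rule e)
  with d show ?case by (auto simp: differentiable_def)
qed

lemma (in bounded_bilinear) C_on_prod:
  assumes "open S" "C_on k S f" "C_on k S g" shows "C_on k S (\<lambda>x. prod (f x) (g x))"
  using assms(2,3)
proof (induction k arbitrary: f g)
  case 0
  then show ?case by (auto intro: continuous_on)
next
  case (Suc k)
  have d: "((\<lambda>x. prod (f x) (g x)) has_derivative
      (\<lambda>v. prod (f x) (frechet_derivative g (at x) v) + prod (frechet_derivative f (at x) v) (g x))) (at x)"
    if "x \<in> S" for x
    using Suc.prems that by (auto simp: frechet_derivative_works intro!: FDERIV)
  have e: "prod (f x) (frechet_derivative g (at x) v) + prod (frechet_derivative f (at x) v) (g x)
      = frechet_derivative (\<lambda>x. prod (f x) (g x)) (at x) v" if "x \<in> S" for x v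
    using fun_cong[OF frechet_derivative_at[OF d[OF that]], of v] .
  have "C_on k S (\<lambda>x. frechet_derivative (\<lambda>x. prod (f x) (g x)) (at x) v)" for v
  proof (rule C_on_cong[OF assms(1)])
    show "C_on k S (\<lambda>x. prod (f x) (frechet_derivative g (at x) v) + prod (frechet_derivative f (at x) v) (g x))" 
      using Suc.prems C_on_Suc_imp[OF Suc.prems(1)] C_on_Suc_imp[OF Suc.prems(2)]
      by (intro C_on_add[OF assms(1) Suc.IH Suc.IH]) simp_all
  qed (rule e)
  with d show ?case by (auto simp: differentiable_def)
qed

lemma (in bounded_linear) C_on_linear:
  assumes "open S" "C_on k S g" shows "C_on k S (\<lambda>x. f (g x))"
  using assms(2)
proof (induction k arbitrary: g)
  case 0
  then show ?case by (auto intro: continuous_on)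
next
  case (Suc k)
  have d: "((\<lambda>x. f (g x)) has_derivative (\<lambda>v. f (frechet_derivative g (at x) v))) (at x)"
    if "x \<in> S" for x
    using Suc.prems that by (auto simp: frechet_derivative_works intro!: has_derivative)
  have e: "f (frechet_derivative g (at x) v) = frechet_derivative (\<lambda>x. f (g x)) (at x) v"
    if "x \<in> S" for x v
    using fun_cong[OF frechet_derivative_at[OF d[OF that]], of v] .
  have "C_on k S (\<lambda>x. frechet_derivative (\<lambda>x. f (g x)) (at x) v)" for v
  proof (rule C_on_cong[OF assms(1)])
    show "C_on k S (\<lambda>x. f (frechet_derivative g (at x) v))" using Suc.prems by (intro Suc.IH) simp_all
  qed (rule e)
  with d show ?case by (auto simp: differentiable_def)
qed

lemma C_on_id: "C_on k S (\<lambda>x. x)"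
proof (cases k)
  case (Suc k)
  have "frechet_derivative (\<lambda>x. x) (at x) = (\<lambda>v. v)" for x :: 'a
    by (rule frechet_derivative_at[symmetric]) (rule has_derivative_ident)
  then show ?thesis using Suc by (simp add: C_on_const)
qed simp

lemma C_on_translate:
  "C_on k S f \<Longrightarrow> C_on k ((+) e ` S) (\<lambda>x. f (x - e))"
proof (induction k arbitrary: f)
  case 0
  then show ?case
    by (auto intro!: continuous_on_compose2[of S f] continuous_intros)
next
  case (Suc k)
  have shift: "((\<lambda>x. f (x - e)) has_derivative D) (at x) \<longleftrightarrow> (f has_derivative D) (at (x - e))" for D x
  proof
    assume "((\<lambda>x. f (x - e)) has_derivative D) (at x)"
    then have "(((\<lambda>x. f (x - e)) \<circ> (\<lambda>y. y + e)) has_derivative D \<circ> (\<lambda>v. v)) (at (x - e))"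
      by (intro diff_chain_at) (auto intro!: derivative_eq_intros)
    then show "(f has_derivative D) (at (x - e))" by (simp add: o_def)
  next
    assume "(f has_derivative D) (at (x - e))"
    then have "((f \<circ> (\<lambda>y. y - e)) has_derivative D \<circ> (\<lambda>v. v)) (at x)"
      by (intro diff_chain_at) (auto intro!: derivative_eq_intros)
    then show "((\<lambda>x. f (x - e)) has_derivative D) (at x)" by (simp add: o_def)
  qed
  then have "frechet_derivative (\<lambda>x. f (x - e)) (at x) = frechet_derivative f (at (x - e))" for x
    unfolding frechet_derivative_def by simp
  moreover have "(\<lambda>x. f (x - e)) differentiable at x \<longleftrightarrow> f differentiable at (x - e)" for x
    unfolding differentiable_def shift ..
  moreover have "C_on k ((+) e ` S) (\<lambda>x. frechet_derivative f (at (x - e)) v)" for v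
    using Suc.IH[of "\<lambda>x. frechet_derivative f (at x) v"] Suc.prems by simp
  ultimately show ?case using Suc.prems by auto
qed

named_theorems smooth_intros

lemma smooth_on_const [smooth_intros]: "smooth_on S (\<lambda>x. c)"
  by (simp add: smooth_on_def C_on_const)

lemma smooth_on_id [smooth_intros]: "smooth_on S (\<lambda>x. x)"
  by (simp add: smooth_on_def C_on_id)

lemma smooth_on_add [smooth_intros]:
  "open S \<Longrightarrow> smooth_on S f \<Longrightarrow> smooth_on S g \<Longrightarrow> smooth_on S (\<lambda>x. f x + g x)"
  by (simp add: smooth_on_def C_on_add)

lemma smooth_on_mult [smooth_intros]:
  fixes f g :: "'a::euclidean_space \<Rightarrow> real"
  shows "open S \<Longrightarrow> smooth_on S f \<Longrightarrow> smooth_on S g \<Longrightarrow> smooth_on S (\<lambda>x. f x * g x)"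
  by (simp add: smooth_on_def bounded_bilinear.C_on_prod[OF bounded_bilinear_mult])

lemma smooth_on_scaleR [smooth_intros]:
  "open S \<Longrightarrow> smooth_on S f \<Longrightarrow> smooth_on S g \<Longrightarrow> smooth_on S (\<lambda>x. f x *\<^sub>R g x)"
  by (simp add: smooth_on_def bounded_bilinear.C_on_prod[OF bounded_bilinear_scaleR])

lemma smooth_on_nth [smooth_intros]:
  "open S \<Longrightarrow> smooth_on S f \<Longrightarrow> smooth_on S (\<lambda>x. f x $ i)"
  by (simp add: smooth_on_def bounded_linear.C_on_linear[OF bounded_linear_vec_nth])

lemma smooth_on_inner_const [smooth_intros]:
  "open S \<Longrightarrow> smooth_on S f \<Longrightarrow> smooth_on S (\<lambda>x. f x \<bullet> b)"
  by (simp add: smooth_on_def bounded_linear.C_on_linear[OF bounded_linear_inner_left])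

lemma smooth_on_sum [smooth_intros]:
  "open S \<Longrightarrow> (\<And>i. i \<in> A \<Longrightarrow> smooth_on S (f i)) \<Longrightarrow> smooth_on S (\<lambda>x. \<Sum>i\<in>A. f i x)"
  by (induction A rule: infinite_finite_induct) (auto intro: smooth_intros)

lemma smooth_on_cong:
  "open S \<Longrightarrow> (\<And>x. x \<in> S \<Longrightarrow> f x = g x) \<Longrightarrow> smooth_on S f \<Longrightarrow> smooth_on S g"
  unfolding smooth_on_def using C_on_cong by blast

lemma smooth_on_subset: "smooth_on S f \<Longrightarrow> T \<subseteq> S \<Longrightarrow> smooth_on T f"
  unfolding smooth_on_def using C_on_subset by blast

lemma smooth_on_imp_differentiable: "smooth_on S f \<Longrightarrow> x \<in> S \<Longrightarrow> f differentiable (at x)"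
  unfolding smooth_on_def by (metis C_on.simps(2))

lemma smooth_on_imp_continuous_on: "smooth_on S f \<Longrightarrow> continuous_on S f"
  unfolding smooth_on_def by (metis C_on.simps(1))

lemma smooth_on_frechet_derivative [smooth_intros]:
  "smooth_on S f \<Longrightarrow> smooth_on S (\<lambda>x. frechet_derivative f (at x) v)"
  unfolding smooth_on_def by (metis C_on.simps(2))

lemma smooth_on_translate:
  "smooth_on S f \<Longrightarrow> smooth_on ((+) e ` S) (\<lambda>x. f (x - e))"
  by (simp add: smooth_on_def C_on_translate)


section \<open>Directional derivatives and the Lie bracket\<close>

definition dirder :: "('a::euclidean_space \<Rightarrow> 'a) \<Rightarrow> ('a \<Rightarrow> real) \<Rightarrow> 'a \<Rightarrow> real" where
  "dirder X f x = frechet_derivative f (at x) (X x)"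

lemma linear_basis_expansion:
  fixes f :: "'a::euclidean_space \<Rightarrow> real"
  assumes "linear f" shows "f v = (\<Sum>b\<in>Basis. (v \<bullet> b) * f b)"
proof -
  have "f v = f (\<Sum>b\<in>Basis. (v \<bullet> b) *\<^sub>R b)" by (simp add: euclidean_representation)
  also have "\<dots> = (\<Sum>b\<in>Basis. (v \<bullet> b) * f b)"
    using assms by (simp add: linear_sum linear_cmul)
  finally show ?thesis .
qed

lemma smooth_on_dirder [smooth_intros]:
  assumes "open S" "smooth_on S X" "smooth_on S f" shows "smooth_on S (dirder X f)"
proof (rule smooth_on_cong)
  show "smooth_on S (\<lambda>x. \<Sum>b\<in>Basis. (X x \<bullet> b) * frechet_derivative f (at x) b)"
    using assms by (intro smooth_intros)
  show "(\<Sum>b\<in>Basis. (X x \<bullet> b) * frechet_derivative f (at x) b) = dirder X f x" if "x \<in> S" for x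
    unfolding dirder_def using assms that
    by (intro linear_basis_expansion[symmetric] linear_frechet_derivative smooth_on_imp_differentiable)
qed fact

lemma frechet_derivative_cong_open:
  assumes "open S" "x \<in> S" "\<And>y. y \<in> S \<Longrightarrow> f y = g y"
  shows "frechet_derivative f (at x) = frechet_derivative g (at x)"
proof -
  have "(f has_derivative D) (at x) \<longleftrightarrow> (g has_derivative D) (at x)" for D
    using has_derivative_transform_within_open[of f D x UNIV S g]
      has_derivative_transform_within_open[of g D x UNIV S f] assms by auto
  then show ?thesis unfolding frechet_derivative_def by simp
qed

lemma dirder_cong:
  assumes "open S" "x \<in> S" "\<And>y. y \<in> S \<Longrightarrow> f y = g y" shows "dirder X f x = dirder X g x"
  unfolding dirder_def using frechet_derivative_cong_open[OF assms] by simp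

lemma frechet_derivative_mult:
  fixes f g :: "'a::real_normed_vector \<Rightarrow> real"
  assumes "f differentiable (at x)" "g differentiable (at x)"
  shows "frechet_derivative (\<lambda>x. f x * g x) (at x) v
    = f x * frechet_derivative g (at x) v + frechet_derivative f (at x) v * g x"
proof -
  have "((\<lambda>x. f x * g x) has_derivative
    (\<lambda>v. f x * frechet_derivative g (at x) v + frechet_derivative f (at x) v * g x)) (at x)"
    using assms by (auto simp: frechet_derivative_works intro!: has_derivative_mult)
  then show ?thesis by (rule fun_cong[OF frechet_derivative_at, symmetric])
qed

lemma frechet_derivative_add:
  assumes "f differentiable (at x)" "g differentiable (at x)"
  shows "frechet_derivative (\<lambda>x. f x + g x) (at x) v
    = frechet_derivative f (at x) v + frechet_derivative g (at x) v"
proof -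
  have "((\<lambda>x. f x + g x) has_derivative
    (\<lambda>v. frechet_derivative f (at x) v + frechet_derivative g (at x) v)) (at x)"
    using assms by (auto simp: frechet_derivative_works intro!: has_derivative_add)
  then show ?thesis by (rule fun_cong[OF frechet_derivative_at, symmetric])
qed

text \<open>
  The second difference is the increment over \<open>[0, h]\<close> of \<open>t \<mapsto> f (x + t u + h v) - f (x + t
  u)\<close>. The mean value theorem turns it into a difference of two values of the derivative in the
  direction \<open>u\<close>, which the differentiability of that function at the single point \<open>x\<close> controls
  up to \<open>o(h)\<close>.
\<close>

lemma second_difference_estimate:
  fixes f :: "'a::real_normed_vector \<Rightarrow> real"
  assumes "open U" "x \<in> U" and f: "\<And>y. y \<in> U \<Longrightarrow> (f has_derivative f' y) (at y)"
    and d: "((\<lambda>y. f' y u) has_derivative F) (at x)" and "0 < e"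
  shows "\<exists>d>0. \<forall>h. 0 < h \<and> h < d \<longrightarrow>
    \<bar>f (x + h *\<^sub>R u + h *\<^sub>R v) - f (x + h *\<^sub>R u) - f (x + h *\<^sub>R v) + f x - h\<^sup>2 * F v\<bar> \<le> e * h\<^sup>2"
proof -
  define c where "c = 2 * (norm u + norm v) + 1"
  have c: "0 < c" by (simp add: c_def add_nonneg_pos)
  obtain r where r: "0 < r" "ball x r \<subseteq> U" using assms(1,2) openE by blast
  interpret F: bounded_linear F using d by (rule has_derivative_bounded_linear)
  obtain r' where r': "0 < r'"
    and D: "\<And>y. norm (y - x) < r' \<Longrightarrow> \<bar>f' y u - f' x u - F (y - x)\<bar> \<le> e / c * norm (y - x)"
    using d c \<open>0 < e\<close> unfolding has_derivative_at_alt by (metis divide_pos_pos real_norm_def)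
  define d where "d = min r r' / c"
  have "\<bar>f (x + h *\<^sub>R u + h *\<^sub>R v) - f (x + h *\<^sub>R u) - f (x + h *\<^sub>R v) + f x - h\<^sup>2 * F v\<bar> \<le> e * h\<^sup>2"
    if h: "0 < h" "h < d" for h
  proof -
    \<comment> \<open>Both arguments of \<open>f\<close> stay in the ball where the derivative is controlled; the constant
      \<open>c\<close> absorbs the factor 2 of the two error terms.\<close>
    define g where "g t = f (x + t *\<^sub>R u + h *\<^sub>R v) - f (x + t *\<^sub>R u)" for t
    have hc: "h * c < min r r'" using h c by (simp add: d_def pos_less_divide_eq)
    have small1: "norm (t *\<^sub>R u + h *\<^sub>R v) \<le> h * (norm u + norm v)" if "0 \<le> t" "t \<le> h" for t
    proof -
      have "norm (t *\<^sub>R u + h *\<^sub>R v) \<le> t * norm u + h * norm v"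
        using that h by (intro norm_triangle_le) simp
      also have "\<dots> \<le> h * norm u + h * norm v" using that by (intro add_right_mono mult_right_mono) auto
      finally show ?thesis by (simp add: algebra_simps)
    qed
    have small2: "norm (t *\<^sub>R u) \<le> h * (norm u + norm v)" if "0 \<le> t" "t \<le> h" for t
      using that h by (simp add: algebra_simps add_increasing mult_right_mono add_increasing2)
    have le: "h * (norm u + norm v) < min r r'"
    proof -
      have "h * (norm u + norm v) \<le> h * c"
        using h by (intro mult_left_mono) (auto simp: c_def)
      then show ?thesis using hc by linarith
    qed
    have inU: "x + t *\<^sub>R u + h *\<^sub>R v \<in> U" "x + t *\<^sub>R u \<in> U" if "0 \<le> t" "t \<le> h" for t
    proof -
      have "dist x (x + t *\<^sub>R u + h *\<^sub>R v) < r" "dist x (x + t *\<^sub>R u) < r"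
        using small1[OF that] small2[OF that] le by (auto simp: dist_norm norm_minus_commute algebra_simps)
      then show "x + t *\<^sub>R u + h *\<^sub>R v \<in> U" "x + t *\<^sub>R u \<in> U" using r by auto
    qed
    have gd: "(g has_derivative (\<lambda>s. s * (f' (x + t *\<^sub>R u + h *\<^sub>R v) u - f' (x + t *\<^sub>R u) u))) (at t)"
      if "0 \<le> t" "t \<le> h" for t
    proof -
      have l: "linear (f' (x + t *\<^sub>R u + h *\<^sub>R v))" "linear (f' (x + t *\<^sub>R u))"
        using f inU[OF that] has_derivative_linear by blast+
      have 1: "((f \<circ> (\<lambda>t. x + t *\<^sub>R u + h *\<^sub>R v)) has_derivative f' (x + t *\<^sub>R u + h *\<^sub>R v) \<circ> (\<lambda>s. s *\<^sub>R u)) (at t)"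
        by (rule diff_chain_at) (auto intro!: derivative_eq_intros f inU that)
      have 2: "((f \<circ> (\<lambda>t. x + t *\<^sub>R u)) has_derivative f' (x + t *\<^sub>R u) \<circ> (\<lambda>s. s *\<^sub>R u)) (at t)"
        by (rule diff_chain_at) (auto intro!: derivative_eq_intros f inU that)
      show ?thesis
        using has_derivative_diff[OF 1 2] l
        by (simp add: o_def g_def[abs_def] linear_cmul algebra_simps)
    qed
    have "\<exists>t\<in>{0<..<h}. g h - g 0 = (h - 0) * (f' (x + t *\<^sub>R u + h *\<^sub>R v) u - f' (x + t *\<^sub>R u) u)"
      using h by (intro mvt_simple has_derivative_at_withinI[OF gd]) auto
    then obtain t where t: "0 < t" "t < h"
      and eq: "g h - g 0 = h * (f' (x + t *\<^sub>R u + h *\<^sub>R v) u - f' (x + t *\<^sub>R u) u)" by auto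
    have ec: "0 < e / c" using \<open>0 < e\<close> c by simp
    have A: "\<bar>f' (x + t *\<^sub>R u + h *\<^sub>R v) u - f' x u - F (t *\<^sub>R u + h *\<^sub>R v)\<bar> \<le> e / c * (h * (norm u + norm v))"
      using D[of "x + t *\<^sub>R u + h *\<^sub>R v"] small1[of t] t le ec
      by (smt (verit, best) add.assoc add_diff_cancel_left' mult_left_mono)
    have B: "\<bar>f' (x + t *\<^sub>R u) u - f' x u - F (t *\<^sub>R u)\<bar> \<le> e / c * (h * (norm u + norm v))"
      using D[of "x + t *\<^sub>R u"] small2[of t] t le ec
      by (smt (verit, best) add_diff_cancel_left' mult_left_mono)
    have "\<bar>f' (x + t *\<^sub>R u + h *\<^sub>R v) u - f' (x + t *\<^sub>R u) u - h * F v\<bar> \<le> 2 * (e / c * (h * (norm u + norm v)))"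
      using A B by (simp add: F.add F.scaleR)
    also have "\<dots> = e * h * (2 * (norm u + norm v) / c)" by simp
    also have "\<dots> \<le> e * h * 1"
      using c \<open>0 < e\<close> h by (intro mult_left_mono) (auto simp: c_def divide_le_eq)
    finally have "\<bar>h\<bar> * \<bar>f' (x + t *\<^sub>R u + h *\<^sub>R v) u - f' (x + t *\<^sub>R u) u - h * F v\<bar> \<le> \<bar>h\<bar> * (e * h)"
      by (intro mult_left_mono) auto
    moreover have "(g h - g 0) - h\<^sup>2 * F v
        = h * (f' (x + t *\<^sub>R u + h *\<^sub>R v) u - f' (x + t *\<^sub>R u) u - h * F v)"
      by (simp add: eq power2_eq_square right_diff_distrib)
    ultimately have "\<bar>(g h - g 0) - h\<^sup>2 * F v\<bar> \<le> e * h\<^sup>2"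
      using h by (simp add: abs_mult power2_eq_square mult.assoc mult.left_commute)
    then show ?thesis by (simp add: g_def algebra_simps)
  qed
  moreover have "0 < d" using r r' c by (simp add: d_def)
  ultimately show ?thesis by blast
qed

text \<open>
  Both second derivatives approximate the same second difference, which is symmetric in \<open>u\<close> and
  \<open>v\<close>.
\<close>

lemma second_derivative_symmetric:
  fixes f :: "'a::real_normed_vector \<Rightarrow> real"
  assumes "open U" "x \<in> U" and f: "\<And>y. y \<in> U \<Longrightarrow> (f has_derivative f' y) (at y)"
    and u: "((\<lambda>y. f' y u) has_derivative F) (at x)" and v: "((\<lambda>y. f' y v) has_derivative G) (at x)"
  shows "F v = G u"
proof (rule ccontr)
  assume "F v \<noteq> G u"
  define e where "e = \<bar>F v - G u\<bar> / 3"
  have e: "0 < e" using \<open>F v \<noteq> G u\<close> by (simp add: e_def)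
  obtain d where d: "0 < d" "\<And>h. 0 < h \<Longrightarrow> h < d \<Longrightarrow>
    \<bar>f (x + h *\<^sub>R u + h *\<^sub>R v) - f (x + h *\<^sub>R u) - f (x + h *\<^sub>R v) + f x - h\<^sup>2 * F v\<bar> \<le> e * h\<^sup>2"
    using second_difference_estimate[OF assms(1,2) f u e, of v] by blast
  obtain d' where d': "0 < d'" "\<And>h. 0 < h \<Longrightarrow> h < d' \<Longrightarrow>
    \<bar>f (x + h *\<^sub>R v + h *\<^sub>R u) - f (x + h *\<^sub>R v) - f (x + h *\<^sub>R u) + f x - h\<^sup>2 * G u\<bar> \<le> e * h\<^sup>2"
    using second_difference_estimate[OF assms(1,2) f v e, of u] by blast
  define h where "h = min d d' / 2"
  have h: "0 < h" "h < d" "h < d'" using d(1) d'(1) by (auto simp: h_def)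
  have "f (x + h *\<^sub>R v + h *\<^sub>R u) = f (x + h *\<^sub>R u + h *\<^sub>R v)" by (simp add: ac_simps)
  then have "\<bar>h\<^sup>2 * F v - h\<^sup>2 * G u\<bar> \<le> 2 * (e * h\<^sup>2)"
    using d(2)[OF h(1,2)] d'(2)[OF h(1,3)] by linarith
  moreover have "h\<^sup>2 * \<bar>F v - G u\<bar> = \<bar>h\<^sup>2 * F v - h\<^sup>2 * G u\<bar>"
    by (metis abs_mult abs_power2 right_diff_distrib)
  ultimately have "h\<^sup>2 * \<bar>F v - G u\<bar> \<le> h\<^sup>2 * (2 * e)" by (simp only: ac_simps)
  then show False using h e by (simp add: e_def)
qed

text \<open>
  The expansion in a basis makes the bilinear expression \<open>f'(y) (X y)\<close> a sum of products of
  scalar functions.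
\<close>

lemma dirder_has_derivative:
  fixes f :: "'a::euclidean_space \<Rightarrow> real"
  assumes "open U" "x \<in> U" "smooth_on U f" "X differentiable (at x)"
  shows "(dirder X f has_derivative (\<lambda>v. frechet_derivative (\<lambda>y. frechet_derivative f (at y) (X x)) (at x) v
    + frechet_derivative f (at x) (frechet_derivative X (at x) v))) (at x)"
proof -
  let ?L = "\<lambda>y. frechet_derivative f (at y)"
  have linear_differential: "linear (?L y)" if "y \<in> U" for y
    using that assms by (intro linear_frechet_derivative smooth_on_imp_differentiable)
  have d2: "((\<lambda>y. ?L y b) has_derivative frechet_derivative (\<lambda>y. ?L y b) (at x)) (at x)" for b
    using assms smooth_on_imp_differentiable[OF smooth_on_frechet_derivative[OF assms(3)]]
    by (simp add: frechet_derivative_works)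
  have dX: "(X has_derivative frechet_derivative X (at x)) (at x)"
    using assms by (simp add: frechet_derivative_works)
  have 1: "((\<lambda>y. \<Sum>b\<in>Basis. (X y \<bullet> b) * ?L y b) has_derivative
      (\<lambda>v. \<Sum>b\<in>Basis. (X x \<bullet> b) * frechet_derivative (\<lambda>y. ?L y b) (at x) v
        + (frechet_derivative X (at x) v \<bullet> b) * ?L x b)) (at x)"
    by (intro has_derivative_sum has_derivative_mult has_derivative_inner_left dX d2)
  have 2: "((\<lambda>y. \<Sum>b\<in>Basis. (X x \<bullet> b) * ?L y b) has_derivative
      (\<lambda>v. \<Sum>b\<in>Basis. (X x \<bullet> b) * frechet_derivative (\<lambda>y. ?L y b) (at x) v)) (at x)"
    by (intro has_derivative_sum has_derivative_mult_right d2)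
  have "((\<lambda>y. ?L y (X x)) has_derivative
      (\<lambda>v. \<Sum>b\<in>Basis. (X x \<bullet> b) * frechet_derivative (\<lambda>y. ?L y b) (at x) v)) (at x)"
    by (rule has_derivative_transform_within_open[OF 2 assms(1,2)])
      (rule linear_basis_expansion[OF linear_differential, symmetric])
  then have 3: "(\<Sum>b\<in>Basis. (X x \<bullet> b) * frechet_derivative (\<lambda>y. ?L y b) (at x) v)
      = frechet_derivative (\<lambda>y. ?L y (X x)) (at x) v" for v
    by (rule fun_cong[OF frechet_derivative_at])
  have "(dirder X f has_derivative (\<lambda>v. \<Sum>b\<in>Basis. (X x \<bullet> b) * frechet_derivative (\<lambda>y. ?L y b) (at x) v
        + (frechet_derivative X (at x) v \<bullet> b) * ?L x b)) (at x)"
    by (rule has_derivative_transform_within_open[OF 1 assms(1,2)])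
      (simp add: dirder_def linear_basis_expansion[OF linear_differential, symmetric])
  then show ?thesis
    unfolding sum.distrib 3 linear_basis_expansion[OF linear_differential[OF assms(2)], symmetric] .
qed

text \<open>
  The terms with second derivatives of \<open>f\<close> cancel by their symmetry.
\<close>

lemma dirder_commutator:
  fixes f :: "real^'n \<Rightarrow> real"
  assumes "open U" "x \<in> U" "smooth_on U f" "X differentiable (at x)" "Y differentiable (at x)"
  shows "frechet_derivative f (at x) (lie_bracket X Y x) = dirder X (dirder Y f) x - dirder Y (dirder X f) x"
proof -
  let ?L = "\<lambda>y. frechet_derivative f (at y)"
  have df: "(f has_derivative ?L y) (at y)" if "y \<in> U" for y
    using smooth_on_imp_differentiable[OF assms(3) that] by (simp add: frechet_derivative_works)
  have d2: "((\<lambda>y. ?L y b) has_derivative frechet_derivative (\<lambda>y. ?L y b) (at x)) (at x)" for b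
    using assms smooth_on_imp_differentiable[OF smooth_on_frechet_derivative[OF assms(3)]]
    by (simp add: frechet_derivative_works)
  have XY: "dirder X (dirder Y f) x = frechet_derivative (\<lambda>y. ?L y (Y x)) (at x) (X x)
      + ?L x (frechet_derivative Y (at x) (X x))"
    using frechet_derivative_at[OF dirder_has_derivative[OF assms(1-3,5)]]
    by (simp add: dirder_def[of X "dirder Y f"] fun_eq_iff)
  have YX: "dirder Y (dirder X f) x = frechet_derivative (\<lambda>y. ?L y (X x)) (at x) (Y x)
      + ?L x (frechet_derivative X (at x) (Y x))"
    using frechet_derivative_at[OF dirder_has_derivative[OF assms(1-4)]]
    by (simp add: dirder_def[of Y "dirder X f"] fun_eq_iff)
  have "frechet_derivative (\<lambda>y. ?L y (Y x)) (at x) (X x) = frechet_derivative (\<lambda>y. ?L y (X x)) (at x) (Y x)"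
    by (rule second_derivative_symmetric[OF assms(1,2) df d2 d2])
  then show ?thesis
    using XY YX linear_diff[OF has_derivative_linear[OF df[OF assms(2)]]]
    by (simp add: lie_bracket_def)
qed

text \<open>
  This is Cartan's formula for the exterior derivative of \<open>df - g dh\<close>, evaluated on two fields
  annihilated by this form. With coordinates for \<open>f, g, h\<close> it computes brackets of sections of a
  Pfaffian system; with the components of a diffeomorphism it says how the pulled back system
  behaves.
\<close>

lemma pullback_form_bracket:
  fixes f g h :: "real^'n \<Rightarrow> real"
  assumes "open U" "x \<in> U" and s: "smooth_on U f" "smooth_on U g" "smooth_on U h"
    and d: "X differentiable (at x)" "Y differentiable (at x)"
    and X: "\<And>y. y \<in> U \<Longrightarrow> dirder X f y = g y * dirder X h y"
    and Y: "\<And>y. y \<in> U \<Longrightarrow> dirder Y f y = g y * dirder Y h y"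
  shows "frechet_derivative f (at x) (lie_bracket X Y x)
    - g x * frechet_derivative h (at x) (lie_bracket X Y x)
    = dirder X g x * dirder Y h x - dirder Y g x * dirder X h x"
proof -
  have dh: "dirder Y h differentiable at x" "dirder X h differentiable at x"
    using dirder_has_derivative[OF assms(1,2) s(3)] d unfolding differentiable_def by blast+
  have dg: "g differentiable at x" using assms smooth_on_imp_differentiable by blast
  have "dirder X (dirder Y f) x = dirder X (\<lambda>y. g y * dirder Y h y) x"
    by (rule dirder_cong[OF assms(1,2)]) (rule Y)
  moreover have "dirder Y (dirder X f) x = dirder Y (\<lambda>y. g y * dirder X h y) x"
    by (rule dirder_cong[OF assms(1,2)]) (rule X)
  ultimately show ?thesis
    unfolding dirder_commutator[OF assms(1,2) s(1) d] dirder_commutator[OF assms(1,2) s(3) d]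
    by (simp add: dirder_def[of X "\<lambda>y. g y * dirder Y h y"] dirder_def[of Y "\<lambda>y. g y * dirder X h y"]
        frechet_derivative_mult[OF dg dh(1)] frechet_derivative_mult[OF dg dh(2)])
      (simp add: dirder_def algebra_simps)
qed


section \<open>A Goursat structure and its derived flag\<close>

text \<open>
  A numbering of the index type, so that the structure can be written down uniformly in the
  dimension.
\<close>

definition coord :: "nat \<Rightarrow> 'n::finite" where
  "coord = (SOME c. bij_betw c {..<CARD('n)} UNIV)"

lemma coord_bij: "bij_betw (coord :: nat \<Rightarrow> 'n::finite) {..<CARD('n)} UNIV"
proof -
  have "\<exists>c :: nat \<Rightarrow> 'n. bij_betw c {..<CARD('n)} UNIV"
    using ex_bij_betw_nat_finite[of "UNIV :: 'n set"] by (simp add: atLeast0LessThan)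
  then show ?thesis unfolding coord_def by (rule someI_ex)
qed

lemma coord_eq_iff:
  "k < CARD('n) \<Longrightarrow> l < CARD('n) \<Longrightarrow> (coord k :: 'n::finite) = coord l \<longleftrightarrow> k = l"
  using coord_bij[where 'n='n] by (auto simp: bij_betw_def inj_on_def)

lemma vec_eq_coordI:
  fixes x y :: "'a^'n"
  assumes "\<And>k. k < CARD('n) \<Longrightarrow> x $ coord k = y $ coord k" shows "x = y"
proof (subst vec_eq_iff, rule allI)
  fix i :: 'n
  obtain k where "k < CARD('n)" "i = coord k"
    using coord_bij[where 'n='n] unfolding bij_betw_def by (metis UNIV_I imageE lessThan_iff)
  then show "x $ i = y $ i" using assms by simp
qed

definition coord_vec :: "nat \<Rightarrow> real^'n" where "coord_vec k = axis (coord k) 1"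

lemma coord_vec_nth:
  "k < CARD('n) \<Longrightarrow> l < CARD('n) \<Longrightarrow> (coord_vec k :: real^'n) $ coord l = (if k = l then 1 else 0)"
  by (auto simp: coord_vec_def axis_def coord_eq_iff)

lemma inner_coord_vec: "p \<bullet> coord_vec k = p $ coord k"
  by (simp add: coord_vec_def inner_axis)

lemma sum_coord_vec_nth:
  assumes "A \<subseteq> {..<CARD('n)}" "l < CARD('n)"
  shows "(\<Sum>k\<in>A. g k *\<^sub>R (coord_vec k :: real^'n)) $ coord l = (if l \<in> A then g l else 0)"
proof -
  have "finite A" using assms(1) finite_subset by blast
  have "(\<Sum>k\<in>A. g k *\<^sub>R (coord_vec k :: real^'n)) $ coord l = (\<Sum>k\<in>A. if k = l then g k else 0)"
    using assms by (auto simp: coord_vec_nth subset_iff intro!: sum.cong)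
  then show ?thesis using \<open>finite A\<close> by simp
qed

text \<open>
  \<open>form j\<close> is \<open>dz a - z (a + 1) dz c\<close>, where \<open>a = form_lead j\<close> and \<open>c = form_base j\<close>. The
  indices reflect the change of the independent variable: it is \<open>z4\<close> in \<open>dz0 - z1 dz4\<close>, \<open>dz1 -
  z2 dz4\<close>, \<open>dz2 - z3 dz4\<close> and \<open>z3\<close> in \<open>dz4 - z5 dz3\<close>, \<open>dz5 - z6 dz3\<close>, and so on.
\<close>

definition form_lead :: "nat \<Rightarrow> nat" where "form_lead j = (if j < 3 then j else Suc j)"
definition form_base :: "nat \<Rightarrow> nat" where "form_base j = (if j < 3 then 4 else 3)"

definition form :: "nat \<Rightarrow> real^'n \<Rightarrow> real^'n \<Rightarrow> real" where
  "form j x v = v $ coord (form_lead j) - x $ coord (Suc (form_lead j)) * v $ coord (form_base j)"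

definition flag :: "nat \<Rightarrow> real^'n \<Rightarrow> (real^'n) set" where
  "flag N x = {v. \<forall>j<N. form j x v = 0}"

text \<open>
  Truncated total derivatives with respect to the independent variables \<open>z4\<close> and \<open>z3\<close>. Together
  with coordinate directions, \<open>total_x N\<close> spans \<open>flag N\<close> for \<open>N \<le> 3\<close> and \<open>total_r N\<close> spans it
  for \<open>N \<ge> 4\<close>.
\<close>

definition total_x :: "nat \<Rightarrow> real^'n \<Rightarrow> real^'n" where
  "total_x N x = coord_vec 4 + (\<Sum>j<N. x $ coord (Suc j) *\<^sub>R coord_vec j)"

definition total_r :: "nat \<Rightarrow> real^'n \<Rightarrow> real^'n" where
  "total_r N x = coord_vec 3 + x $ coord 5 *\<^sub>R total_x 3 x + (\<Sum>k=5..N. x $ coord (Suc k) *\<^sub>R coord_vec k)"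

definition std_frame :: "nat \<Rightarrow> nat \<Rightarrow> real^'n \<Rightarrow> real^'n" where
  "std_frame N i = (if i = 0 then total_r N else (\<lambda>x. coord_vec (N + i)))"

lemma linear_form: "linear (form j x)"
  by (rule linearI) (simp_all add: form_def algebra_simps)

lemma subspace_flag: "subspace (flag N x)"
  by (simp add: flag_def subspace_def linear_add[OF linear_form] linear_cmul[OF linear_form] linear_0[OF linear_form])

lemma flag_mono: "M \<le> N \<Longrightarrow> flag N x \<subseteq> flag M x"
  by (auto simp: flag_def)

lemma smooth_total_x [smooth_intros]: "smooth_on UNIV (total_x N)"
  unfolding total_x_def by (intro smooth_intros open_UNIV)

lemma smooth_total_r [smooth_intros]: "smooth_on UNIV (total_r N)"
  unfolding total_r_def by (intro smooth_intros open_UNIV)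

lemma dim_kernel_step:
  fixes S :: "'a::euclidean_space set" and f :: "'a \<Rightarrow> real"
  assumes S: "subspace S" and f: "linear f" and v: "v \<in> S" "f v \<noteq> 0"
  shows "dim S = Suc (dim (S \<inter> {x. f x = 0}))"
proof -
  let ?T = "S \<inter> {x. f x = 0}"
  have T: "subspace ?T"
    using S f by (intro subspace_inter) (auto simp: subspace_def linear_add linear_cmul linear_0)
  have "span (insert v ?T) = S"
  proof (rule subset_antisym)
    show "span (insert v ?T) \<subseteq> S" using S v by (intro span_minimal) auto
    show "S \<subseteq> span (insert v ?T)"
    proof
      fix x assume x: "x \<in> S"
      have "x - (f x / f v) *\<^sub>R v \<in> ?T"
        using x v S f by (auto simp: linear_diff linear_cmul intro: subspace_diff subspace_scale)
      then have "(x - (f x / f v) *\<^sub>R v) + (f x / f v) *\<^sub>R v \<in> span (insert v ?T)"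
        by (intro span_add span_scale) (auto intro: span_base)
      then show "x \<in> span (insert v ?T)" by simp
    qed
  qed
  then have "dim S = dim (insert v ?T)" by (metis dim_span)
  also have "\<dots> = Suc (dim ?T)"
    using v by (simp add: dim_insert span_eq_iff[THEN iffD2, OF T])
  finally show ?thesis .
qed

lemma frechet_derivative_nth:
  assumes "f differentiable (at x)"
  shows "frechet_derivative (\<lambda>y. f y $ i) (at x) v = frechet_derivative f (at x) v $ i"
proof -
  have "((\<lambda>y. f y $ i) has_derivative (\<lambda>v. frechet_derivative f (at x) v $ i)) (at x)"
    using assms by (auto simp: frechet_derivative_works
      intro!: bounded_linear.has_derivative[OF bounded_linear_vec_nth])
  then show ?thesis by (rule fun_cong[OF frechet_derivative_at, symmetric])
qed

lemma form_eq_dirder: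
  assumes "smooth_on S f" "x \<in> S"
  shows "form j (f x) (frechet_derivative f (at x) (X x)) = dirder X (\<lambda>y. f y $ coord (form_lead j)) x
     - f x $ coord (Suc (form_lead j)) * dirder X (\<lambda>y. f y $ coord (form_base j)) x"
  using smooth_on_imp_differentiable[OF assms] by (simp add: form_def dirder_def frechet_derivative_nth)

text \<open>
  The map \<open>f\<close> is the identity when the flag is computed, and a local symmetry later on.
\<close>

lemma form_bracket:
  fixes f :: "real^'n \<Rightarrow> real^'n"
  assumes S: "open S" "x \<in> S" "smooth_on S f"
    and d: "X differentiable (at x)" "Y differentiable (at x)"
    and X: "\<And>y. y \<in> S \<Longrightarrow> form j (f y) (frechet_derivative f (at y) (X y)) = 0"
    and Y: "\<And>y. y \<in> S \<Longrightarrow> form j (f y) (frechet_derivative f (at y) (Y y)) = 0"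
  shows "form j (f x) (frechet_derivative f (at x) (lie_bracket X Y x)) =
    frechet_derivative f (at x) (X x) $ coord (Suc (form_lead j)) * frechet_derivative f (at x) (Y x) $ coord (form_base j)
    - frechet_derivative f (at x) (Y x) $ coord (Suc (form_lead j)) * frechet_derivative f (at x) (X x) $ coord (form_base j)"
proof -
  note df = smooth_on_imp_differentiable[OF S(3,2)]
  have "frechet_derivative (\<lambda>y. f y $ coord (form_lead j)) (at x) (lie_bracket X Y x)
    - f x $ coord (Suc (form_lead j)) * frechet_derivative (\<lambda>y. f y $ coord (form_base j)) (at x) (lie_bracket X Y x)
    = dirder X (\<lambda>y. f y $ coord (Suc (form_lead j))) x * dirder Y (\<lambda>y. f y $ coord (form_base j)) x
    - dirder Y (\<lambda>y. f y $ coord (Suc (form_lead j))) x * dirder X (\<lambda>y. f y $ coord (form_base j)) x"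
    using X Y by (intro pullback_form_bracket[OF S(1,2) _ _ _ d] smooth_on_nth S)
      (simp_all add: form_eq_dirder[OF S(3)])
  then show ?thesis by (simp add: form_def dirder_def frechet_derivative_nth[OF df])
qed

text \<open>
  The right-hand side of the preceding formula is a \<open>2 \<times> 2\<close> minor in the differentials of \<open>z b\<close>
  and \<open>z c\<close>, \<open>b = form_lead j + 1\<close>, \<open>c = form_base j\<close>. It vanishes because the next form makes
  one of these two differentials a multiple of the other.
\<close>

lemma form_bracket_zero:
  fixes f :: "real^'n \<Rightarrow> real^'n"
  assumes S: "open S" "x \<in> S" "smooth_on S f"
    and d: "X differentiable (at x)" "Y differentiable (at x)"
    and X: "\<And>y. y \<in> S \<Longrightarrow> frechet_derivative f (at y) (X y) \<in> flag N (f y)"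
    and Y: "\<And>y. y \<in> S \<Longrightarrow> frechet_derivative f (at y) (Y y) \<in> flag N (f y)"
  shows "frechet_derivative f (at x) (lie_bracket X Y x) \<in> flag (N - 1) (f x)"
  unfolding flag_def
proof (rule CollectI, intro allI impI)
  fix j assume j: "j < N - 1"
  let ?d = "frechet_derivative f (at x)"
  have "form (Suc j) (f x) (?d (X x)) = 0" "form (Suc j) (f x) (?d (Y x)) = 0"
    using X[OF S(2)] Y[OF S(2)] j by (auto simp: flag_def)
  then have "?d (X x) $ coord (Suc (form_lead j)) * ?d (Y x) $ coord (form_base j)
      = ?d (Y x) $ coord (Suc (form_lead j)) * ?d (X x) $ coord (form_base j)"
    \<comment> \<open>For \<open>j = 2\<close> the independent variable changes: \<open>form 3\<close> expresses \<open>dz4\<close> by \<open>dz3\<close>, whereas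
      for the other \<open>j\<close> it is \<open>dz b\<close> that is expressed by \<open>dz c\<close>.\<close>
    by (cases "j = 2") (auto simp: form_def form_lead_def form_base_def eval_nat_numeral split: if_splits)
  then show "form j (f x) (?d (lie_bracket X Y x)) = 0"
    using X Y j by (subst form_bracket[OF S d]) (auto simp: flag_def)
qed

lemma frechet_derivative_id: "frechet_derivative (\<lambda>x. x) (at x) v = v"
  by (metis frechet_derivative_ident)

context
  assumes card: "9 \<le> CARD('n::finite)"
begin

lemma total_x_nth:
  assumes "N \<le> 3" "l < CARD('n)"
  shows "total_x N (x :: real^'n) $ coord l = (if l = 4 then 1 else if l < N then x $ coord (Suc l) else 0)"
proof -
  have "(\<Sum>k<N. x $ coord (Suc k) *\<^sub>R (coord_vec k :: real^'n)) $ coord l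
      = (if l \<in> {..<N} then x $ coord (Suc l) else 0)"
    using assms card by (intro sum_coord_vec_nth) auto
  then show ?thesis using assms card by (simp add: total_x_def coord_vec_nth)
qed

lemma total_r_nth:
  assumes "N \<le> CARD('n) - 2" "l < CARD('n)"
  shows "total_r N (x :: real^'n) $ coord l = (if l = 3 then 1 else if l < 3 then x $ coord 5 * x $ coord (Suc l)
     else if l = 4 then x $ coord 5 else if l \<le> N then x $ coord (Suc l) else 0)"
proof -
  have "(\<Sum>k=5..N. x $ coord (Suc k) *\<^sub>R (coord_vec k :: real^'n)) $ coord l
      = (if l \<in> {5..N} then x $ coord (Suc l) else 0)"
    using assms card by (intro sum_coord_vec_nth) auto
  then show ?thesis using assms card by (simp add: total_r_def total_x_nth coord_vec_nth)
qed

lemma total_x_in_flag: "N \<le> 3 \<Longrightarrow> total_x N (x :: real^'n) \<in> flag N x"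
  using card by (auto simp: flag_def form_def form_lead_def form_base_def total_x_nth)

lemma total_r_in_flag: "N \<le> CARD('n) - 2 \<Longrightarrow> total_r N (x :: real^'n) \<in> flag N x"
  using card by (auto simp: flag_def form_def form_lead_def form_base_def total_r_nth)

lemma coord_vec_in_flag: "N \<le> k \<Longrightarrow> k < CARD('n) \<Longrightarrow> k \<noteq> 4 \<Longrightarrow> (k \<noteq> N \<or> N \<le> 3) \<Longrightarrow> (coord_vec k :: real^'n) \<in> flag N x"
  using card by (auto simp: flag_def form_def form_lead_def form_base_def coord_vec_nth)

text \<open>
  The leading coordinate of \<open>form N\<close> does not occur in the earlier forms, except that \<open>dz4\<close>,
  the leading term of \<open>form 3\<close>, is the independent variable of the forms 0, 1, 2. There the
  total derivative corrects the coordinate direction.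
\<close>

lemma form_independent:
  assumes "N < CARD('n) - 2" shows "\<exists>v\<in>flag N (x :: real^'n). form N x v \<noteq> 0"
proof (cases "N = 3")
  case True
  then show ?thesis
    using card by (intro bexI[of _ "total_x 3 x"]) (auto simp: form_def form_lead_def form_base_def total_x_nth total_x_in_flag)
next
  case False
  then show ?thesis
    using card assms by (intro bexI[of _ "coord_vec (form_lead N)"]) (auto simp: flag_def form_def form_lead_def form_base_def coord_vec_nth)
qed

lemma dim_flag: "N \<le> CARD('n) - 2 \<Longrightarrow> dim (flag N (x :: real^'n)) = CARD('n) - N"
proof (induction N)
  case 0
  then show ?case by (simp add: flag_def)
next
  case (Suc N)
  then obtain v where "v \<in> flag N x" "form N x v \<noteq> 0" using form_independent[of N x] by auto
  then have "dim (flag N x) = Suc (dim (flag N x \<inter> {v. form N x v = 0}))"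
    by (intro dim_kernel_step subspace_flag linear_form)
  moreover have "flag N x \<inter> {v. form N x v = 0} = flag (Suc N) x"
    by (auto simp: flag_def less_Suc_eq)
  ultimately show ?case using Suc by simp
qed

lemma derived_on_flag_subset: "derived_on UNIV (flag N) (x :: real^'n) \<subseteq> flag (N - 1) x"
  unfolding derived_on_def
proof (rule span_minimal[OF _ subspace_flag], rule Un_least)
  show "flag N x \<subseteq> flag (N - 1) x" by (rule flag_mono) simp
  show "{lie_bracket X Y x | X Y S. open S \<and> x \<in> S \<and> S \<subseteq> UNIV \<and> smooth_on S X \<and> smooth_on S Y \<and>
        (\<forall>y\<in>S. X y \<in> flag N y \<and> Y y \<in> flag N y)} \<subseteq> flag (N - 1) x"
  proof clarify
    fix X Y S
    assume "open S" "x \<in> S" "smooth_on S X" "smooth_on S Y" "\<forall>y\<in>S. X y \<in> flag N y \<and> Y y \<in> flag N y"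
    then show "lie_bracket X Y x \<in> flag (N - 1) x"
      using form_bracket_zero[of S x "\<lambda>x. x" X Y N]
      by (simp add: smooth_on_id smooth_on_imp_differentiable frechet_derivative_id)
  qed
qed

text \<open>
  Differentiating the total derivative with respect to the coefficient of \<open>form N\<close>, which is a
  free coordinate of \<open>flag (N + 1)\<close>, produces the leading direction of \<open>form N\<close>.
\<close>

lemma bracket_transversal:
  assumes "Suc N \<le> CARD('n) - 2"
  shows "\<exists>X Y. smooth_on UNIV X \<and> smooth_on UNIV Y \<and> (\<forall>y. X y \<in> flag (Suc N) y \<and> Y y \<in> flag (Suc N) y) \<and>
    form N x (lie_bracket X Y (x :: real^'n)) \<noteq> 0"
proof -
  define X :: "real^'n \<Rightarrow> real^'n" where "X y = coord_vec (if N < 3 then Suc N else Suc (Suc N))" for y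
  define Y :: "real^'n \<Rightarrow> real^'n" where "Y = (if N < 3 then total_x (Suc N) else total_r (Suc N))"
  have s: "smooth_on UNIV X" "smooth_on UNIV Y"
    by (auto simp: X_def[abs_def] Y_def intro: smooth_intros)
  have "X y \<in> flag (Suc N) y" "Y y \<in> flag (Suc N) y" for y
    using assms by (auto simp: X_def Y_def intro!: coord_vec_in_flag total_x_in_flag total_r_in_flag)
  note m = this
  then have "form N y (X y) = 0" "form N y (Y y) = 0" for y by (auto simp: flag_def)
  then have "form N x (lie_bracket X Y x)
     = X x $ coord (Suc (form_lead N)) * Y x $ coord (form_base N) - Y x $ coord (Suc (form_lead N)) * X x $ coord (form_base N)"
    using form_bracket[of UNIV x "\<lambda>x. x" X Y N] s
    by (simp add: smooth_on_id smooth_on_imp_differentiable frechet_derivative_id)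
  also have "\<dots> = 1"
    using assms card by (auto simp: X_def Y_def form_lead_def form_base_def coord_vec_nth total_x_nth total_r_nth)
  finally show ?thesis using s m by (intro exI[of _ X] exI[of _ Y]) auto
qed

text \<open>
  The bracket of the preceding lemma lies in \<open>flag (N - 1)\<close> but not in \<open>flag N\<close>, which has
  codimension one in it. For \<open>N = 0\<close> both sides are the whole tangent space; the truncated
  subtraction takes care of the members of the derived flag beyond the last proper one.
\<close>

lemma derived_on_flag:
  assumes "N \<le> CARD('n) - 2"
  shows "derived_on UNIV (flag N) = (flag (N - 1) :: real^'n \<Rightarrow> _)"
proof (rule ext, rule subset_antisym[OF derived_on_flag_subset])
  fix x :: "real^'n"
  have sub: "flag N x \<subseteq> derived_on UNIV (flag N) x" by (auto simp: derived_on_def intro: span_base)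
  show "flag (N - 1) x \<subseteq> derived_on UNIV (flag N) x"
  proof (cases N)
    case 0
    then show ?thesis using sub by simp
  next
    case (Suc M)
    then obtain X Y where XY: "smooth_on UNIV X" "smooth_on UNIV Y" "\<forall>y. X y \<in> flag N y \<and> Y y \<in> flag N y"
      and n0: "form M x (lie_bracket X Y x) \<noteq> 0"
      using bracket_transversal[of M x] assms by auto
    let ?b = "lie_bracket X Y x"
    have b: "?b \<in> derived_on UNIV (flag N) x"
      unfolding derived_on_def using XY by (intro span_base UnI2 CollectI exI[of _ X] exI[of _ Y] exI[of _ UNIV]) auto
    then have bE: "?b \<in> flag M x" using derived_on_flag_subset[of N x] Suc by auto
    show ?thesis
    proof
      fix v assume "v \<in> flag (N - 1) x"
      then have v: "v \<in> flag M x" using Suc by simp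
      define c where "c = form M x v / form M x ?b"
      have "v - c *\<^sub>R ?b \<in> flag N x"
        using v bE n0 unfolding Suc flag_def
        by (auto simp: less_Suc_eq linear_diff[OF linear_form] linear_cmul[OF linear_form] c_def)
      then have "(v - c *\<^sub>R ?b) + c *\<^sub>R ?b \<in> derived_on UNIV (flag N) x"
        using sub b unfolding derived_on_def by (intro span_add span_scale) auto
      then show "v \<in> derived_on UNIV (flag N) x" by simp
    qed
  qed
qed

lemma funpow_derived_on_flag: 
  "(derived_on UNIV ^^ i) (flag (CARD('n) - 2)) = (flag (CARD('n) - 2 - i) :: real^'n \<Rightarrow> _)"
  by (induction i) (simp_all add: derived_on_flag)

lemma flag_expansion:
  assumes N: "4 \<le> N" "N \<le> CARD('n) - 2" and v: "v \<in> flag N (x :: real^'n)"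
  shows "v = v $ coord 3 *\<^sub>R total_r N x + (\<Sum>k\<in>{N<..<CARD('n)}. v $ coord k *\<^sub>R coord_vec k)"
proof (rule vec_eq_coordI)
  fix l assume l: "l < CARD('n)"
  have f: "form j x v = 0" if "j < N" for j using v that by (auto simp: flag_def)
  have "(\<Sum>k\<in>{N<..<CARD('n)}. v $ coord k *\<^sub>R (coord_vec k :: real^'n)) $ coord l = (if N < l then v $ coord l else 0)"
    using l by (subst sum_coord_vec_nth) auto
  moreover have "v $ coord l = v $ coord 3 * total_r N x $ coord l" if "l \<le> N"
  proof (cases "l < 5")
    case True
    then consider "l < 3" | "l = 3" | "l = 4" by linarith
    then show ?thesis
      using f[of l] f[of 3] N l card by cases (auto simp: total_r_nth form_def form_lead_def form_base_def)
  next
    case False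
    then obtain j where "l = Suc j" "4 \<le> j" by (cases l) auto
    then show ?thesis
      using f[of j] that N l by (auto simp: total_r_nth form_def form_lead_def form_base_def)
  qed
  moreover have "total_r N x $ coord l = 0" if "N < l" using that N l by (simp add: total_r_nth)
  ultimately show "v $ coord l = (v $ coord 3 *\<^sub>R total_r N x + (\<Sum>k\<in>{N<..<CARD('n)}. v $ coord k *\<^sub>R coord_vec k)) $ coord l"
    by auto
qed

lemma local_frame_std_frame:
  assumes N: "4 \<le> N" "N \<le> CARD('n) - 2"
  shows "local_frame (flag N) UNIV (CARD('n) - N) (std_frame N :: nat \<Rightarrow> real^'n \<Rightarrow> real^'n)"
  unfolding local_frame_def
proof (intro conjI ballI allI impI)
  show "smooth_on UNIV (std_frame N i :: real^'n \<Rightarrow> real^'n)" for i by (auto simp: std_frame_def intro: smooth_intros)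
  fix x :: "real^'n"
  show "dim (flag N x) = CARD('n) - N" by (rule dim_flag[OF N(2)])
  show "flag N x = span ((\<lambda>i. std_frame N i x) ` {..<CARD('n) - N})"
  proof (rule subset_antisym)
    show "span ((\<lambda>i. std_frame N i x) ` {..<CARD('n) - N}) \<subseteq> flag N x"
      using N by (intro span_minimal subspace_flag) (auto simp: std_frame_def intro!: total_r_in_flag coord_vec_in_flag)
    show "flag N x \<subseteq> span ((\<lambda>i. std_frame N i x) ` {..<CARD('n) - N})"
    proof
      fix v assume v: "v \<in> flag N x"
      have "total_r N x \<in> (\<lambda>i. std_frame N i x) ` {..<CARD('n) - N}"
        using N by (intro image_eqI[of _ _ 0]) (auto simp: std_frame_def)
      moreover have "coord_vec k \<in> (\<lambda>i. std_frame N i x) ` {..<CARD('n) - N}" if "k \<in> {N<..<CARD('n)}" for k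
        using that by (intro image_eqI[of _ _ "k - N"]) (auto simp: std_frame_def)
      ultimately show "v \<in> span ((\<lambda>i. std_frame N i x) ` {..<CARD('n) - N})"
        by (subst flag_expansion[OF N v]) (intro span_add span_scale span_sum span_base)
    qed
  qed
qed simp

end


section \<open>Derivatives on the zero set of a function\<close>

lemma countable_isolated_points:
  fixes Z :: "real set"
  shows "countable {t\<in>Z. \<not> t islimpt Z}"
proof -
  obtain \<B> :: "real set set" where \<B>: "countable \<B>" "\<And>C. C \<in> \<B> \<Longrightarrow> open C"
    "\<And>S. open S \<Longrightarrow> \<exists>U. U \<subseteq> \<B> \<and> S = \<Union>U"
    by (rule univ_second_countable) blast
  have "{t\<in>Z. \<not> t islimpt Z} \<subseteq> (\<lambda>B. the_elem (B \<inter> Z)) ` \<B>"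
  proof
    fix t assume "t \<in> {t\<in>Z. \<not> t islimpt Z}"
    then obtain T where T: "t \<in> Z" "t \<in> T" "open T" "\<forall>y\<in>Z. y \<in> T \<longrightarrow> y = t"
      unfolding islimpt_def by blast
    then obtain B where "B \<in> \<B>" "t \<in> B" "B \<subseteq> T" using \<B>(3)[of T] by blast
    moreover from this T have "B \<inter> Z = {t}" by blast
    ultimately show "t \<in> (\<lambda>B. the_elem (B \<inter> Z)) ` \<B>" by (intro image_eqI[of _ _ B]) simp_all
  qed
  then show ?thesis by (rule countable_subset) (intro countable_image \<B>(1))
qed

text \<open>
  At an accumulation point of its zero set a differentiable function has derivative zero, and
  the isolated points of a set of reals are countable. The set of parameters is cut out by an
  arbitrary predicate, such as the nonvanishing of a control that is only measurable.
\<close>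

lemma AE_zero_derivative:
  fixes f f' :: "real \<Rightarrow> real"
  assumes z: "AE t in lebesgue. Q t \<longrightarrow> f t = 0"
    and d: "AE t in lebesgue. Q t \<longrightarrow> (f has_real_derivative f' t) (at t within J)"
    and J: "\<And>t. Q t \<Longrightarrow> t \<in> J"
  shows "AE t in lebesgue. Q t \<longrightarrow> f' t = 0"
proof -
  define Z where "Z = {t\<in>J. f t = 0}"
  have "AE t in lebesgue. t \<notin> {t\<in>Z. \<not> t islimpt Z}"
    by (intro AE_not_in null_sets_completionI countable_imp_null_set_lborel countable_isolated_points)
  with z d show ?thesis
  proof eventually_elim
    case (elim t)
    show ?case
    proof
      assume Q: "Q t"
      then have t: "t \<in> Z" using elim(1) J by (auto simp: Z_def)
      then have l: "t islimpt Z" using elim(3) by auto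
      have "((\<lambda>y. (f y - f t) / (y - t)) \<longlongrightarrow> f' t) (at t within Z)"
        using elim(2) Q has_field_derivative_subset[of f "f' t" t J Z]
        by (auto simp: Z_def has_field_derivative_iff)
      moreover have "((\<lambda>y. (f y - f t) / (y - t)) \<longlongrightarrow> 0) (at t within Z)"
        using t by (intro tendsto_eventually) (auto simp: Z_def eventually_at_filter)
      moreover have "at t within Z \<noteq> bot" using l by (simp add: trivial_limit_within)
      ultimately show "f' t = 0" using tendsto_unique by blast
    qed
  qed
qed


section \<open>Coordinate space as a manifold\<close>

definition coord_space :: "(real^'n, 'n::finite) manifold" where
  "coord_space = \<lparr>mtop = euclidean, atlas = {(UNIV, id)}\<rparr>"

definition jet_distr :: "(real^'n, 'n::finite) distr" where
  "jet_distr = (\<lambda>C. flag (CARD('n) - 2))"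

lemma coord_space_simps [simp]: "mtop coord_space = euclidean" "atlas coord_space = {(UNIV, id)}"
  by (simp_all add: coord_space_def)

lemma coord_rep_id [simp]: "coord_rep (UNIV, id) (UNIV, id) \<phi> = \<phi>"
  by (simp add: coord_rep_def o_def)

lemma coord_diff_id [simp]: "coord_diff (UNIV, id) (UNIV, id) \<phi> x = frechet_derivative \<phi> (at x)"
  by (simp add: coord_diff_def)

definition loc_abs_cont :: "real set \<Rightarrow> (real \<Rightarrow> 'a::metric_space) \<Rightarrow> bool" where
  "loc_abs_cont I x \<longleftrightarrow> (\<forall>a b. a \<le> b \<longrightarrow> {a..b} \<subseteq> I \<longrightarrow> abs_cont a b x)"

text \<open>
  This is what \<open>abnormal_lift\<close> amounts to when there is just one chart.
\<close>

definition covector_lift ::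
  "(real^'n \<Rightarrow> (real^'n) set) \<Rightarrow> real set \<Rightarrow> (real \<Rightarrow> real^'n) \<Rightarrow> (real \<Rightarrow> real^'n) \<Rightarrow> bool" where
  "covector_lift F I \<gamma> p \<longleftrightarrow> (\<forall>t\<in>I. p t \<noteq> 0) \<and> loc_abs_cont I p \<and>
     (\<forall>t0\<in>I. \<exists>S k f r u. local_frame F S k f \<and> 0 < r \<and> (\<forall>t \<in> I \<inter> ball t0 r. \<gamma> t \<in> S) \<and>
        (\<forall>i<k. (\<lambda>t. u t i) \<in> borel_measurable (lebesgue_on (I \<inter> ball t0 r))) \<and>
        hamilton_eqs k f (I \<inter> ball t0 r) \<gamma> p u)"

lemma frechet_derivative_id_fun: "frechet_derivative id (at x) = id"
  by (simp add: id_def frechet_derivative_id fun_eq_iff)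

lemma abnormal_lift_coord_space: "abnormal_lift coord_space D I \<gamma> p \<longleftrightarrow> covector_lift (D (UNIV, id)) I \<gamma> (p (UNIV, id))"
  by (simp add: abnormal_lift_def covector_lift_def abs_cont_comps_def loc_abs_cont_def frechet_derivative_id_fun)

lemma abnormal_curve_coord_space:
  "abnormal_curve coord_space D I \<gamma> \<longleftrightarrow> is_interval I \<and> interior I \<noteq> {} \<and> continuous_on I \<gamma> \<and>
     loc_abs_cont I \<gamma> \<and> (\<exists>p. covector_lift (D (UNIV, id)) I \<gamma> p)"
proof -
  have "(\<exists>p. abnormal_lift coord_space D I \<gamma> p) \<longleftrightarrow> (\<exists>p. covector_lift (D (UNIV, id)) I \<gamma> p)"
    unfolding abnormal_lift_coord_space by (rule iffI) (blast, elim exE, rule_tac x = "\<lambda>C. p" in exI, simp)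
  then show ?thesis
    by (simp add: abnormal_curve_def abs_cont_curve_def abs_cont_comps_def loc_abs_cont_def)
qed

lemma abs_cont_mono:
  assumes x: "abs_cont a b x" and d: "\<And>s t. a \<le> s \<Longrightarrow> s \<le> t \<Longrightarrow> t \<le> b \<Longrightarrow> dist (y s) (y t) \<le> dist (x s) (x t)"
  shows "abs_cont a b y"
  unfolding abs_cont_def
proof (intro allI impI)
  fix e :: real assume "0 < e"
  then obtain \<delta> where \<delta>: "0 < \<delta>" "\<And>P. finite P \<Longrightarrow> \<forall>(s, t)\<in>P. a \<le> s \<and> s \<le> t \<and> t \<le> b \<Longrightarrow>
     pairwise (\<lambda>(s, t) (s', t'). {s<..<t} \<inter> {s'<..<t'} = {}) P \<Longrightarrow>
     (\<Sum>(s, t)\<in>P. t - s) < \<delta> \<Longrightarrow> (\<Sum>(s, t)\<in>P. dist (x s) (x t)) < e"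
    using x unfolding abs_cont_def by (elim allE[of _ e]) auto
  show "\<exists>\<delta>>0. \<forall>P. finite P \<longrightarrow> (\<forall>(s, t)\<in>P. a \<le> s \<and> s \<le> t \<and> t \<le> b) \<longrightarrow>
     pairwise (\<lambda>(s, t) (s', t'). {s<..<t} \<inter> {s'<..<t'} = {}) P \<longrightarrow>
     (\<Sum>(s, t)\<in>P. t - s) < \<delta> \<longrightarrow> (\<Sum>(s, t)\<in>P. dist (y s) (y t)) < e"
  proof (intro exI conjI allI impI)
    fix P assume P: "finite P" "\<forall>(s, t)\<in>P. a \<le> s \<and> s \<le> t \<and> t \<le> b"
     "pairwise (\<lambda>(s, t) (s', t'). {s<..<t} \<inter> {s'<..<t'} = {}) P" "(\<Sum>(s, t)\<in>P. t - s) < \<delta>"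
    have "(\<Sum>(s, t)\<in>P. dist (y s) (y t)) \<le> (\<Sum>(s, t)\<in>P. dist (x s) (x t))"
      using P(2) d by (intro sum_mono) auto
    then show "(\<Sum>(s, t)\<in>P. dist (y s) (y t)) < e" using \<delta>(2)[OF P] by linarith
  qed fact
qed

lemma loc_abs_cont_mono:
  assumes "loc_abs_cont I x" "\<And>s t. s \<in> I \<Longrightarrow> t \<in> I \<Longrightarrow> dist (y s) (y t) \<le> dist (x s) (x t)"
  shows "loc_abs_cont I y"
  unfolding loc_abs_cont_def
proof (intro allI impI)
  fix a b :: real assume ab: "a \<le> b" "{a..b} \<subseteq> I"
  show "abs_cont a b y"
  proof (rule abs_cont_mono)
    show "abs_cont a b x" using assms(1) ab unfolding loc_abs_cont_def by blast
    fix s t assume "a \<le> s" "s \<le> t" "t \<le> b"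
    then have "s \<in> {a..b}" "t \<in> {a..b}" by simp_all
    then show "dist (y s) (y t) \<le> dist (x s) (x t)" using assms(2) ab(2) by blast
  qed
qed


section \<open>The Hamilton equations\<close>

lemma hamiltonian_control:
  assumes "j < k"
  shows "((\<lambda>s. hamiltonian k f x p (u(j := s))) has_real_derivative 0) (at (u j)) \<longleftrightarrow> p \<bullet> f j x = 0"
proof -
  have "hamiltonian k f x p (u(j := s)) = s * (p \<bullet> f j x) + p \<bullet> (\<Sum>i\<in>{..<k} - {j}. u i *\<^sub>R f i x)" for s
    using assms by (simp add: hamiltonian_def sum.remove[of _ j] inner_add_right)
  then have "((\<lambda>s. hamiltonian k f x p (u(j := s))) has_real_derivative p \<bullet> f j x) (at (u j))"
    by (auto intro!: derivative_eq_intros)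
  then show ?thesis using DERIV_unique by metis
qed

lemma hamiltonian_controls:
  "(\<forall>j<k. ((\<lambda>s. hamiltonian k f x p (u(j := s))) has_real_derivative 0) (at (u j)))
    \<longleftrightarrow> (\<forall>j<k. p \<bullet> f j x = 0)"
  using hamiltonian_control[of _ k f x p u] by blast

lemma hamiltonian_momentum:
  "(GDERIV (\<lambda>y. hamiltonian k f y p u) x :> - p') \<longleftrightarrow>
    ((\<lambda>y. p \<bullet> (\<Sum>i<k. u i *\<^sub>R f i y)) has_derivative (\<lambda>v. - (v \<bullet> p'))) (at x)"
  by (simp add: gderiv_def hamiltonian_def)

lemma hamiltonian_velocity:
  "(GDERIV (\<lambda>q. hamiltonian k f x q u) p :> x') \<longleftrightarrow> x' = (\<Sum>i<k. u i *\<^sub>R f i x)"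
proof -
  have d: "GDERIV (\<lambda>q. hamiltonian k f x q u) p :> (\<Sum>i<k. u i *\<^sub>R f i x)"
    unfolding gderiv_def hamiltonian_def by (auto intro!: derivative_eq_intros)
  have "x' = (\<Sum>i<k. u i *\<^sub>R f i x)" if "GDERIV (\<lambda>q. hamiltonian k f x q u) p :> x'"
  proof -
    have "(\<lambda>h. h \<bullet> x') = (\<lambda>h. h \<bullet> (\<Sum>i<k. u i *\<^sub>R f i x))"
      by (rule has_derivative_unique[OF that[unfolded gderiv_def] d[unfolded gderiv_def]])
    then have "\<forall>h. h \<bullet> x' = h \<bullet> (\<Sum>i<k. u i *\<^sub>R f i x)" by (intro allI) (rule fun_cong)
    then show ?thesis by (simp only: vector_eq_ldot)
  qed
  with d show ?thesis by auto
qed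

text \<open>
  The Hamilton equations with the gradients in \<open>p\<close> and \<open>u\<close> evaluated: the Hamiltonian is linear
  in both variables.
\<close>

lemma hamilton_eqs_alt:
  "hamilton_eqs k f J x p u \<longleftrightarrow> (AE t in lebesgue. t \<in> J \<longrightarrow>
     (x has_vector_derivative (\<Sum>i<k. u t i *\<^sub>R f i (x t))) (at t within J) \<and>
     (\<exists>p'. (p has_vector_derivative p') (at t within J) \<and>
       ((\<lambda>y. p t \<bullet> (\<Sum>i<k. u t i *\<^sub>R f i y)) has_derivative (\<lambda>v. - (v \<bullet> p'))) (at (x t))) \<and>
     (\<forall>j<k. p t \<bullet> f j (x t) = 0))"
  unfolding hamilton_eqs_def hamiltonian_velocity hamiltonian_momentum hamiltonian_controls
  by (intro AE_cong) blast

lemma lebesgue_interval_ball: "is_interval I \<Longrightarrow> I \<inter> ball (t0::real) r \<in> sets lebesgue"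
  by (intro sets.Int sets_completionI_sets)
    (auto intro: real_interval_borel_measurable)

context
  assumes card: "9 \<le> CARD('n::finite)"
begin

lemma derived_flag_jet_distr: "derived_flag jet_distr i (UNIV, id) = (flag (CARD('n) - 2 - i) :: real^'n \<Rightarrow> _)"
  by (simp add: derived_flag_def jet_distr_def funpow_derived_on_flag[OF card])

text \<open>
  The coefficient of \<open>form j\<close> is \<open>z (form_lead j + 1)\<close>, and \<open>z8\<close> appears first in \<open>form 6\<close>.
\<close>

lemma flag_translate:
  assumes "N \<le> 6" shows "flag N (x + s *\<^sub>R coord_vec 8 :: real^'n) = flag N x"
proof -
  have "form j (x + s *\<^sub>R coord_vec 8 :: real^'n) = form j x" if "j < N" for j
    using assms that card by (auto simp: form_def form_lead_def coord_vec_nth fun_eq_iff)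
  then show ?thesis by (auto simp: flag_def)
qed

lemma covector_lift_translate:
  assumes N: "N \<le> 6" and l: "covector_lift (flag N) I \<gamma> p" and \<gamma>': "\<And>t. t \<in> I \<Longrightarrow> \<gamma>' t = \<gamma> t + s *\<^sub>R (coord_vec 8 :: real^'n)"
  shows "covector_lift (flag N) I \<gamma>' p"
  unfolding covector_lift_def
proof (intro conjI ballI)
  show "p t \<noteq> 0" if "t \<in> I" for t using l that by (simp add: covector_lift_def)
  show "loc_abs_cont I p" using l by (simp add: covector_lift_def)
  let ?e = "s *\<^sub>R (coord_vec 8 :: real^'n)"
  fix t0 assume "t0 \<in> I"
  then obtain S k f r u where fr: "local_frame (flag N) S k f" and r: "0 < r"
    and S: "\<forall>t \<in> I \<inter> ball t0 r. \<gamma> t \<in> S"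
    and u: "\<forall>i<k. (\<lambda>t. u t i) \<in> borel_measurable (lebesgue_on (I \<inter> ball t0 r))"
    and h: "hamilton_eqs k f (I \<inter> ball t0 r) \<gamma> p u"
    using l unfolding covector_lift_def by blast
  let ?f = "\<lambda>i x. f i (x - ?e)"
  have "local_frame (flag N) ((+) ?e ` S) k ?f"
    unfolding local_frame_def
  proof (intro conjI allI impI ballI)
    show "open ((+) ?e ` S)" using fr by (intro open_translation) (simp add: local_frame_def)
    show "smooth_on ((+) ?e ` S) (?f i)" if "i < k" for i
      using fr that by (intro smooth_on_translate) (simp add: local_frame_def)
    fix x assume "x \<in> (+) ?e ` S"
    then have x: "x - ?e \<in> S" by auto
    have eq: "flag N x = flag N (x - ?e)" using flag_translate[OF N, of "x - ?e" s] by simp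
    show "flag N x = span ((\<lambda>i. ?f i x) ` {..<k})" "dim (flag N x) = k"
      unfolding eq using fr x unfolding local_frame_def by blast+
  qed
  moreover have "hamilton_eqs k ?f (I \<inter> ball t0 r) \<gamma>' p u"
    using h unfolding hamilton_eqs_alt
  proof (eventually_elim, intro impI)
    case (elim t)
    assume t: "t \<in> I \<inter> ball t0 r"
    then have g: "\<gamma>' t - ?e = \<gamma> t" using \<gamma>' by simp
    obtain p' where p': "(p has_vector_derivative p') (at t within I \<inter> ball t0 r)"
      and d: "((\<lambda>y. p t \<bullet> (\<Sum>i<k. u t i *\<^sub>R f i y)) has_derivative (\<lambda>v. - (v \<bullet> p'))) (at (\<gamma> t))"
      using elim t by blast
    have "(((\<lambda>y. p t \<bullet> (\<Sum>i<k. u t i *\<^sub>R f i y)) \<circ> (\<lambda>y. y - ?e)) has_derivative (\<lambda>v. - (v \<bullet> p')) \<circ> (\<lambda>v. v)) (at (\<gamma>' t))"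
      by (rule diff_chain_at) (use d g in \<open>auto intro!: derivative_eq_intros\<close>)
    then have 1: "((\<lambda>y. p t \<bullet> (\<Sum>i<k. u t i *\<^sub>R ?f i y)) has_derivative (\<lambda>v. - (v \<bullet> p'))) (at (\<gamma>' t))"
      by (simp add: o_def)
    have "((\<lambda>t. \<gamma> t + ?e) has_vector_derivative (\<Sum>i<k. u t i *\<^sub>R f i (\<gamma> t))) (at t within I \<inter> ball t0 r)"
      using elim t by (auto intro!: derivative_eq_intros)
    then have 2: "(\<gamma>' has_vector_derivative (\<Sum>i<k. u t i *\<^sub>R f i (\<gamma> t))) (at t within I \<inter> ball t0 r)"
      by (rule has_vector_derivative_transform[OF t, rotated]) (use \<gamma>' in auto)
    show "(\<gamma>' has_vector_derivative (\<Sum>i<k. u t i *\<^sub>R ?f i (\<gamma>' t))) (at t within I \<inter> ball t0 r) \<and>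
     (\<exists>p'. (p has_vector_derivative p') (at t within I \<inter> ball t0 r) \<and>
       ((\<lambda>y. p t \<bullet> (\<Sum>i<k. u t i *\<^sub>R ?f i y)) has_derivative (\<lambda>v. - (v \<bullet> p'))) (at (\<gamma>' t))) \<and>
     (\<forall>j<k. p t \<bullet> ?f j (\<gamma>' t) = 0)"
      using 1 2 p' elim t unfolding g by blast
  qed
  moreover have "\<forall>t \<in> I \<inter> ball t0 r. \<gamma>' t \<in> (+) ?e ` S" using S \<gamma>' by (auto simp: add.commute)
  ultimately show "\<exists>S k f r u. local_frame (flag N) S k f \<and> 0 < r \<and> (\<forall>t \<in> I \<inter> ball t0 r. \<gamma>' t \<in> S) \<and>
        (\<forall>i<k. (\<lambda>t. u t i) \<in> borel_measurable (lebesgue_on (I \<inter> ball t0 r))) \<and>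
        hamilton_eqs k f (I \<inter> ball t0 r) \<gamma>' p u"
    using r u by blast
qed

end


section \<open>Abnormal curves\<close>

lemma has_derivative_nth: "((\<lambda>x. x $ i) has_derivative (\<lambda>v. v $ i)) F"
  by (rule bounded_linear_imp_has_derivative[OF bounded_linear_vec_nth])

lemma total_x_has_derivative: "(total_x N has_derivative (\<lambda>v. \<Sum>j<N. v $ coord (Suc j) *\<^sub>R coord_vec j)) (at x)"
proof -
  have "(total_x N has_derivative (\<lambda>v. 0 + (\<Sum>j<N. v $ coord (Suc j) *\<^sub>R coord_vec j))) (at x)"
    unfolding total_x_def
    by (intro has_derivative_add has_derivative_const has_derivative_sum
        has_derivative_scaleR_left has_derivative_nth)
  then show ?thesis by simp
qed

lemma total_r_has_derivative:
  "(total_r N has_derivative (\<lambda>v. v $ coord 5 *\<^sub>R total_x 3 x + x $ coord 5 *\<^sub>R (\<Sum>j<3. v $ coord (Suc j) *\<^sub>R coord_vec j)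
     + (\<Sum>k=5..N. v $ coord (Suc k) *\<^sub>R coord_vec k))) (at x)"
proof -
  have "(total_r N has_derivative (\<lambda>v. 0 + (x $ coord 5 *\<^sub>R (\<Sum>j<3. v $ coord (Suc j) *\<^sub>R coord_vec j)
     + v $ coord 5 *\<^sub>R total_x 3 x) + (\<Sum>k=5..N. v $ coord (Suc k) *\<^sub>R coord_vec k))) (at x)"
    unfolding total_r_def
    by (intro has_derivative_add has_derivative_const has_derivative_sum has_derivative_scaleR
        has_derivative_scaleR_left has_derivative_nth total_x_has_derivative)
  then show ?thesis by (simp add: add.commute)
qed

lemma inner_total_x: "p \<bullet> total_x N x = p $ coord 4 + (\<Sum>j<N. x $ coord (Suc j) * p $ coord j)"
  by (simp add: total_x_def inner_add_right inner_sum_right inner_coord_vec)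

lemma inner_total_r: "p \<bullet> total_r N x = p $ coord 3 + x $ coord 5 * (p \<bullet> total_x 3 x) + (\<Sum>k=5..N. x $ coord (Suc k) * p $ coord k)"
  by (simp add: total_r_def inner_add_right inner_sum_right inner_coord_vec)

context
  assumes card: "9 \<le> CARD('n::finite)"
begin

lemma total_r_partial:
  fixes x p :: "real^'n"
  assumes "N \<le> CARD('n) - 2" "l < CARD('n)"
  shows "p \<bullet> frechet_derivative (total_r N) (at x) (coord_vec l) =
    (if l = 5 then p \<bullet> total_x 3 x else if l \<in> {1,2,3} then x $ coord 5 * p $ coord (l - 1)
     else if 6 \<le> l \<and> l \<le> Suc N then p $ coord (l - 1) else 0)"
proof -
  have 1: "(\<Sum>k=5..N. (coord_vec l :: real^'n) $ coord (Suc k) * p $ coord k) = (if 6 \<le> l \<and> l \<le> Suc N then p $ coord (l - 1) else 0)"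
  proof -
    have "(\<Sum>k=5..N. (coord_vec l :: real^'n) $ coord (Suc k) * p $ coord k) = (\<Sum>k=5..N. if k = l - 1 \<and> 1 \<le> l then p $ coord k else 0)"
      using assms card by (intro sum.cong) (auto simp: coord_vec_nth)
    also have "\<dots> = (if 6 \<le> l \<and> l \<le> Suc N then p $ coord (l - 1) else 0)"
      by (cases l) (auto simp: eval_nat_numeral)
    finally show ?thesis .
  qed
  have 2: "(\<Sum>j<3. (coord_vec l :: real^'n) $ coord (Suc j) * p $ coord j) = (if l \<in> {1,2,3} then p $ coord (l - 1) else 0)"
    using assms card by (auto simp: eval_nat_numeral coord_vec_nth)
  have "p \<bullet> frechet_derivative (total_r N) (at x) (coord_vec l) = (coord_vec l :: real^'n) $ coord 5 * (p \<bullet> total_x 3 x)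
      + x $ coord 5 * (\<Sum>j<3. (coord_vec l :: real^'n) $ coord (Suc j) * p $ coord j)
      + (\<Sum>k=5..N. (coord_vec l :: real^'n) $ coord (Suc k) * p $ coord k)"
    by (simp add: frechet_derivative_at[OF total_r_has_derivative, symmetric] inner_add_right inner_sum_right inner_coord_vec)
  then show ?thesis unfolding 1 2 using assms card by (auto simp: coord_vec_nth)
qed

text \<open>
  The control term of an arbitrary frame, with the controls frozen, is a section \<open>X\<close> of the
  flag, so \<open>X = X3 total_r N\<close> modulo coordinate directions annihilated by the covector. As the
  covector also annihilates \<open>total_r N\<close> at the point, the product rule shows that only \<open>X3\<close>
  times the gradient of \<open>p \<bullet> total_r N\<close> enters the adjoint equation.
\<close>

lemma hamilton_standard_frame:
  fixes f :: "nat \<Rightarrow> real^'n \<Rightarrow> real^'n"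
  assumes N: "4 \<le> N" "N \<le> CARD('n) - 2"
    and fr: "local_frame (flag N) S k f" "x \<in> S"
    and p: "\<forall>j<k. p \<bullet> f j x = 0"
    and d: "((\<lambda>y. p \<bullet> (\<Sum>i<k. u i *\<^sub>R f i y)) has_derivative (\<lambda>v. - (v \<bullet> p'))) (at x)"
  shows "(\<Sum>i<k. u i *\<^sub>R f i x) \<in> flag N x" "\<And>v. v \<in> flag N x \<Longrightarrow> p \<bullet> v = 0"
    "\<And>v. v \<bullet> p' = - ((\<Sum>i<k. u i *\<^sub>R f i x) $ coord 3 * (p \<bullet> frechet_derivative (total_r N) (at x) v))"
proof -
  define X where "X y = (\<Sum>i<k. u i *\<^sub>R f i y)" for y
  have X: "X y \<in> flag N y" if "y \<in> S" for y
    using fr(1) that unfolding X_def local_frame_def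
    by (auto intro!: span_sum span_scale intro: span_base)
  then show "(\<Sum>i<k. u i *\<^sub>R f i x) \<in> flag N x" using fr(2) by (simp add: X_def)
  show pE: "p \<bullet> v = 0" if "v \<in> flag N x" for v
  proof -
    have "v \<in> span ((\<lambda>i. f i x) ` {..<k})" using fr that unfolding local_frame_def by blast
    then show ?thesis
      by (induction rule: span_induct_alt) (use p in \<open>auto simp: inner_add_right\<close>)
  qed
  have pk: "p $ coord k = 0" if "N < k" "k < CARD('n)" for k
    using pE[OF coord_vec_in_flag[OF card, of N k x]] that N by (auto simp: inner_coord_vec)
  have S: "open S" using fr by (simp add: local_frame_def)
  have dX: "X differentiable (at x)"
    unfolding X_def using fr unfolding local_frame_def
    by (intro smooth_on_imp_differentiable[of S]) (auto intro!: smooth_intros)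
  have e: "p \<bullet> X y = X y $ coord 3 * (p \<bullet> total_r N y)" if "y \<in> S" for y
    using pk by (subst flag_expansion[OF card N X[OF that]]) (simp add: inner_add_right inner_sum_right inner_coord_vec)
  have dV: "(total_r N has_derivative frechet_derivative (total_r N) (at x)) (at x)"
    using total_r_has_derivative[of N x] by (subst frechet_derivative_works[symmetric]) (rule differentiableI)
  have dX': "(X has_derivative frechet_derivative X (at x)) (at x)"
    using dX by (simp add: frechet_derivative_works)
  have dX3: "((\<lambda>y. X y $ coord 3) has_derivative (\<lambda>v. frechet_derivative X (at x) v $ coord 3)) (at x)"
    by (rule bounded_linear.has_derivative[OF bounded_linear_vec_nth dX'])
  have "((\<lambda>y. X y $ coord 3 * (p \<bullet> total_r N y)) has_derivative
    (\<lambda>v. X x $ coord 3 * (p \<bullet> frechet_derivative (total_r N) (at x) v)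
      + frechet_derivative X (at x) v $ coord 3 * (p \<bullet> total_r N x))) (at x)"
    by (intro has_derivative_mult dX3 has_derivative_inner_right dV)
  then have "((\<lambda>y. p \<bullet> X y) has_derivative
    (\<lambda>v. X x $ coord 3 * (p \<bullet> frechet_derivative (total_r N) (at x) v)
      + frechet_derivative X (at x) v $ coord 3 * (p \<bullet> total_r N x))) (at x)"
    by (rule has_derivative_transform_within_open[OF _ S fr(2)]) (simp add: e)
  from has_derivative_unique[OF this d[folded X_def]] pE[OF total_r_in_flag[OF card N(2)]]
  have "X x $ coord 3 * (p \<bullet> frechet_derivative (total_r N) (at x) v) = - (v \<bullet> p')" for v
    by (simp add: fun_eq_iff)
  then show "v \<bullet> p' = - ((\<Sum>i<k. u i *\<^sub>R f i x) $ coord 3 * (p \<bullet> frechet_derivative (total_r N) (at x) v))" for v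
    by (simp add: X_def)
qed

lemma flag_components:
  assumes "7 \<le> N" "v \<in> flag N (x :: real^'n)"
  shows "v $ coord 0 = x $ coord 1 * (x $ coord 5 * v $ coord 3)" "v $ coord 1 = x $ coord 2 * (x $ coord 5 * v $ coord 3)"
    "v $ coord 2 = x $ coord 3 * (x $ coord 5 * v $ coord 3)" "v $ coord 4 = x $ coord 5 * v $ coord 3"
    "v $ coord 5 = x $ coord 6 * v $ coord 3" "v $ coord 6 = x $ coord 7 * v $ coord 3"
proof -
  have f: "form j x v = 0" if "j < 7" for j using assms that by (auto simp: flag_def)
  show "v $ coord 0 = x $ coord 1 * (x $ coord 5 * v $ coord 3)" "v $ coord 1 = x $ coord 2 * (x $ coord 5 * v $ coord 3)"
    "v $ coord 2 = x $ coord 3 * (x $ coord 5 * v $ coord 3)" "v $ coord 4 = x $ coord 5 * v $ coord 3"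
    "v $ coord 5 = x $ coord 6 * v $ coord 3" "v $ coord 6 = x $ coord 7 * v $ coord 3"
    using f[of 0] f[of 1] f[of 2] f[of 3] f[of 4] f[of 5]
    by (simp_all add: form_def form_lead_def form_base_def numeral_2_eq_2[symmetric])
qed

text \<open>
  Let \<open>w\<close> be the velocity of \<open>z3\<close>. By the adjoint equation the derivatives of the components of
  the covector \<open>p\<close> are \<open>- w\<close> times the preceding ones: \<open>p l' = - w p (l - 1)\<close> for \<open>6 \<le> l \<le> N +
  1\<close>, \<open>p 5' = - w K\<close> with \<open>K = p \<bullet> total_x 3\<close>, \<open>K' = w p 2\<close>, \<open>p 2' = - w z5 p 1\<close> and \<open>p 1' = - w
  z5 p 0\<close>. As \<open>p (N + 1) = 0\<close>, all of these vanish one after the other almost everywhere on the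
  set \<open>w \<noteq> 0\<close>. Where \<open>z5 \<noteq> 0\<close> this leaves no component of \<open>p\<close>; hence \<open>z5 = 0\<close> there, and then
  \<open>z5' = w z6\<close> and \<open>z6' = w z7\<close> contradict \<open>z7 > 0\<close>.
\<close>

lemma abnormal_velocity_3_zero:
  fixes f :: "nat \<Rightarrow> real^'n \<Rightarrow> real^'n"
  assumes N: "7 \<le> N" "N \<le> CARD('n) - 2"
    and fr: "local_frame (flag N) S k f" and S: "\<And>t. t \<in> J \<Longrightarrow> \<gamma> t \<in> S"
    and reg: "\<And>t. t \<in> J \<Longrightarrow> 0 < \<gamma> t $ coord 7" and p0: "\<And>t. t \<in> J \<Longrightarrow> p t \<noteq> 0"
    and h: "hamilton_eqs k f J \<gamma> p u"
  shows "AE t in lebesgue. t \<in> J \<longrightarrow> (\<Sum>i<k. u t i *\<^sub>R f i (\<gamma> t)) \<in> flag N (\<gamma> t) \<and>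
    (\<Sum>i<k. u t i *\<^sub>R f i (\<gamma> t)) $ coord 3 = 0"
proof -
  define X where "X t = (\<Sum>i<k. u t i *\<^sub>R f i (\<gamma> t))" for t
  define w where "w t = X t $ coord 3" for t
  define Q where "Q t \<longleftrightarrow> t \<in> J \<and> w t \<noteq> 0" for t
  have N4: "4 \<le> N" using N by simp
  have good: "AE t in lebesgue. t \<in> J \<longrightarrow> (\<gamma> has_vector_derivative X t) (at t within J) \<and>
      X t \<in> flag N (\<gamma> t) \<and> (\<forall>v\<in>flag N (\<gamma> t). p t \<bullet> v = 0) \<and>
      (\<exists>p'. (p has_vector_derivative p') (at t within J) \<and>
        (\<forall>v. v \<bullet> p' = - (w t * (p t \<bullet> frechet_derivative (total_r N) (at (\<gamma> t)) v))))"
    using h unfolding hamilton_eqs_alt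
  proof (eventually_elim, intro impI)
    case (elim t)
    assume t: "t \<in> J"
    obtain p' where p': "(p has_vector_derivative p') (at t within J)"
      and d: "((\<lambda>y. p t \<bullet> (\<Sum>i<k. u t i *\<^sub>R f i y)) has_derivative (\<lambda>v. - (v \<bullet> p'))) (at (\<gamma> t))"
      using elim t by blast
    have c: "\<forall>j<k. p t \<bullet> f j (\<gamma> t) = 0" using elim t by blast
    note * = hamilton_standard_frame[OF N4 N(2) fr S[OF t] c d]
    have v: "(\<gamma> has_vector_derivative X t) (at t within J)" using elim t by (simp add: X_def)
    show "(\<gamma> has_vector_derivative X t) (at t within J) \<and>
      X t \<in> flag N (\<gamma> t) \<and> (\<forall>v\<in>flag N (\<gamma> t). p t \<bullet> v = 0) \<and>
      (\<exists>p'. (p has_vector_derivative p') (at t within J) \<and>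
        (\<forall>v. v \<bullet> p' = - (w t * (p t \<bullet> frechet_derivative (total_r N) (at (\<gamma> t)) v))))"
      using *(1,2) *(3) p' v unfolding w_def X_def by blast
  qed
  have dx: "AE t in lebesgue. t \<in> J \<longrightarrow> ((\<lambda>t. \<gamma> t $ coord l) has_real_derivative X t $ coord l) (at t within J)" for l
    using good
  proof eventually_elim
    case (elim t)
    then show ?case
      by (auto simp: has_real_derivative_iff_has_vector_derivative
        intro: bounded_linear.has_vector_derivative[OF bounded_linear_vec_nth])
  qed
  have dp: "AE t in lebesgue. t \<in> J \<longrightarrow> ((\<lambda>t. p t $ coord l) has_real_derivative
      - (w t * (p t \<bullet> frechet_derivative (total_r N) (at (\<gamma> t)) (coord_vec l)))) (at t within J)" for l
    using good
  proof eventually_elim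
    case (elim t)
    show ?case
    proof
      assume "t \<in> J"
      then obtain p' where p': "(p has_vector_derivative p') (at t within J)"
        "\<forall>v. v \<bullet> p' = - (w t * (p t \<bullet> frechet_derivative (total_r N) (at (\<gamma> t)) v))" using elim by blast
      have "p' $ coord l = - (w t * (p t \<bullet> frechet_derivative (total_r N) (at (\<gamma> t)) (coord_vec l)))"
        using p'(2)[rule_format, of "coord_vec l"] by (simp add: inner_commute[of "coord_vec l"] inner_coord_vec)
      then show "((\<lambda>t. p t $ coord l) has_real_derivative
        - (w t * (p t \<bullet> frechet_derivative (total_r N) (at (\<gamma> t)) (coord_vec l)))) (at t within J)"
        using bounded_linear.has_vector_derivative[OF bounded_linear_vec_nth p'(1), of "coord l"]
        by (simp add: has_real_derivative_iff_has_vector_derivative)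
    qed
  qed
  have zero: "AE t in lebesgue. R t \<longrightarrow> F' t = 0"
    if "AE t in lebesgue. R t \<longrightarrow> F t = 0" "\<And>t. R t \<Longrightarrow> Q t"
      "AE t in lebesgue. t \<in> J \<longrightarrow> (F has_real_derivative F' t) (at t within J)" for R F F'
  proof (rule AE_zero_derivative[OF that(1)])
    show "AE t in lebesgue. R t \<longrightarrow> (F has_real_derivative F' t) (at t within J)"
      using that(3) by eventually_elim (use that(2) in \<open>auto simp: Q_def\<close>)
    show "t \<in> J" if "R t" for t using \<open>R t \<Longrightarrow> Q t\<close> that by (simp add: Q_def)
  qed
  have zeroQ: "AE t in lebesgue. Q t \<longrightarrow> F' t = 0"
    if "AE t in lebesgue. Q t \<longrightarrow> F t = 0"
      "AE t in lebesgue. t \<in> J \<longrightarrow> (F has_real_derivative F' t) (at t within J)" for F F'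
    by (rule zero[OF that(1) _ that(2)])
  have top: "AE t in lebesgue. t \<in> J \<longrightarrow> p t $ coord l = 0" if "N < l" "l < CARD('n)" for l
    using good
  proof eventually_elim
    case (elim t)
    then show ?case
      using coord_vec_in_flag[OF card, of N l "\<gamma> t"] that N by (auto simp: inner_coord_vec)
  qed
  have chain: "AE t in lebesgue. Q t \<longrightarrow> p t $ coord l = 0" if "5 \<le> l" "l \<le> Suc N" for l
    using that(2)
  proof (induction rule: inc_induct)
    case base
    have "AE t in lebesgue. t \<in> J \<longrightarrow> p t $ coord (Suc N) = 0" by (rule top) (use N in auto)
    then show ?case by eventually_elim (simp add: Q_def)
  next
    case (step l')
    have "AE t in lebesgue. Q t \<longrightarrow> - (w t * (p t \<bullet> frechet_derivative (total_r N) (at (\<gamma> t)) (coord_vec (Suc l')))) = 0"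
      by (rule zero[OF step.IH _ dp])
    then show ?case
      using step.hyps that(1) N by (simp add: total_r_partial) (auto simp: Q_def elim!: eventually_mono)
  qed
  have K: "AE t in lebesgue. Q t \<longrightarrow> p t \<bullet> total_x 3 (\<gamma> t) = 0"
  proof -
    have "AE t in lebesgue. Q t \<longrightarrow> - (w t * (p t \<bullet> frechet_derivative (total_r N) (at (\<gamma> t)) (coord_vec 5))) = 0"
      by (rule zero[OF chain _ dp]) (use N in auto)
    then show ?thesis using N card by (simp add: total_r_partial) (auto simp: Q_def elim!: eventually_mono)
  qed
  have dK: "AE t in lebesgue. t \<in> J \<longrightarrow> ((\<lambda>t. p t \<bullet> total_x 3 (\<gamma> t)) has_real_derivative w t * p t $ coord 2) (at t within J)"
    using good dp[of 0] dp[of 1] dp[of 2] dp[of 4] dx[of 1] dx[of 2] dx[of 3]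
  proof eventually_elim
    case (elim t)
    show ?case
    proof
      assume t: "t \<in> J"
      then have X: "X t \<in> flag N (\<gamma> t)" using elim(1) by blast
      have "((\<lambda>t. p t $ coord 4 + (\<gamma> t $ coord 1 * p t $ coord 0 + \<gamma> t $ coord 2 * p t $ coord 1 + \<gamma> t $ coord 3 * p t $ coord 2))
        has_real_derivative w t * p t $ coord 2) (at t within J)"
        using t elim(2-) flag_components[OF N(1) X] N card
        by (auto intro!: derivative_eq_intros simp: total_r_partial w_def algebra_simps)
      then show "((\<lambda>t. p t \<bullet> total_x 3 (\<gamma> t)) has_real_derivative w t * p t $ coord 2) (at t within J)"
        by (simp add: inner_total_x eval_nat_numeral)
    qed
  qed
  have P2: "AE t in lebesgue. Q t \<longrightarrow> p t $ coord 2 = 0"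
    using zero[OF K _ dK] by (auto simp: Q_def elim!: eventually_mono)
  have P1: "AE t in lebesgue. Q t \<longrightarrow> \<gamma> t $ coord 5 * p t $ coord 1 = 0"
  proof -
    have "AE t in lebesgue. Q t \<longrightarrow> - (w t * (p t \<bullet> frechet_derivative (total_r N) (at (\<gamma> t)) (coord_vec 2))) = 0"
      by (rule zero[OF P2 _ dp])
    then show ?thesis using N card by (simp add: total_r_partial) (auto simp: Q_def elim!: eventually_mono)
  qed
  \<comment> \<open>The last steps divide by \<open>z5\<close>, which is possible on a smaller set only.\<close>
  define R where "R t \<longleftrightarrow> Q t \<and> \<gamma> t $ coord 5 \<noteq> 0" for t
  have R1: "AE t in lebesgue. R t \<longrightarrow> p t $ coord 1 = 0"
    using P1 by (auto simp: R_def elim!: eventually_mono)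
  have R0: "AE t in lebesgue. R t \<longrightarrow> p t $ coord 0 = 0"
  proof -
    have "AE t in lebesgue. R t \<longrightarrow> - (w t * (p t \<bullet> frechet_derivative (total_r N) (at (\<gamma> t)) (coord_vec 1))) = 0"
      by (rule zero[OF R1 _ dp]) (simp add: R_def)
    then show ?thesis using N card by (simp add: total_r_partial) (auto simp: Q_def R_def elim!: eventually_mono)
  qed
  have chain': "AE t in lebesgue. \<forall>l\<in>{5..Suc N}. Q t \<longrightarrow> p t $ coord l = 0"
    using chain by (intro AE_finite_allI) auto
  have notR: "AE t in lebesgue. \<not> R t"
    using good chain' K P2 R1 R0
  proof eventually_elim
    case (elim t)
    show ?case
    proof
      assume R: "R t"
      then have Q: "Q t" and t: "t \<in> J" by (auto simp: R_def Q_def)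
      have E0: "p t \<bullet> v = 0" if "v \<in> flag N (\<gamma> t)" for v using elim(1) t that by blast
      have hi: "p t $ coord l = 0" if "5 \<le> l" "l < CARD('n)" for l
      proof (cases "l \<le> Suc N")
        case True
        then show ?thesis using elim(2) that Q by simp
      next
        case False
        then show ?thesis using E0[OF coord_vec_in_flag[OF card, of N l]] that N by (simp add: inner_coord_vec)
      qed
      have lo: "p t $ coord 0 = 0" "p t $ coord 1 = 0" "p t $ coord 2 = 0" "p t \<bullet> total_x 3 (\<gamma> t) = 0"
        using elim(3-) Q R by auto
      then have 4: "p t $ coord 4 = 0" by (simp add: inner_total_x eval_nat_numeral)
      have "p t \<bullet> total_r N (\<gamma> t) = 0" by (rule E0[OF total_r_in_flag[OF card N(2)]])
      moreover have "(\<Sum>k=5..N. \<gamma> t $ coord (Suc k) * p t $ coord k) = 0"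
        using hi N by (intro sum.neutral) auto
      ultimately have 3: "p t $ coord 3 = 0" using lo(4) by (simp add: inner_total_r)
      have "p t $ coord l = 0" if "l < CARD('n)" for l
      proof -
        consider "l = 0" | "l = 1" | "l = 2" | "l = 3" | "l = 4" | "5 \<le> l" by linarith
        then show ?thesis using lo 3 4 hi that by cases auto
      qed
      then have "p t = 0" by (intro vec_eq_coordI) simp
      then show False using p0[OF t] by simp
    qed
  qed
  then have X5: "AE t in lebesgue. Q t \<longrightarrow> \<gamma> t $ coord 5 = 0" by (auto simp: R_def elim!: eventually_mono)
  have X6: "AE t in lebesgue. Q t \<longrightarrow> \<gamma> t $ coord 6 = 0"
    using zeroQ[OF X5 dx] good
  proof eventually_elim
    case (elim t)
    then show ?case using flag_components(5)[OF N(1), of "X t" "\<gamma> t"] by (auto simp: Q_def w_def)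
  qed
  have "AE t in lebesgue. \<not> Q t"
    using zeroQ[OF X6 dx] good
  proof eventually_elim
    case (elim t)
    then show ?case using flag_components(6)[OF N(1), of "X t" "\<gamma> t"] reg[of t] by (auto simp: Q_def w_def)
  qed
  with good show ?thesis by eventually_elim (auto simp: Q_def w_def X_def)
qed

text \<open>
  Along a curve with vanishing velocity of \<open>z3\<close> also \<open>z0\<close>, ..., \<open>z N\<close> have velocity zero almost
  everywhere, and \<open>dz0 - z1 dz4\<close> is a solution of the adjoint equation. It annihilates the flag
  at the shifted curve too, since it does not involve \<open>z8\<close>. With \<open>z1\<close> taken along the curve the
  lift inherits the absolute continuity of the curve.
\<close>

lemma covector_lift_shift_vertical:
  assumes N: "7 \<le> N" "N \<le> CARD('n) - 2" and I: "is_interval I" "continuous_on I \<gamma>" "loc_abs_cont I \<gamma>"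
    and reg: "\<And>t. t \<in> I \<Longrightarrow> 0 < \<gamma> t $ coord 7"
    and l: "covector_lift (flag N) I \<gamma> p" and \<gamma>': "\<And>t. t \<in> I \<Longrightarrow> \<gamma>' t = \<gamma> t + s *\<^sub>R (coord_vec 8 :: real^'n)"
  shows "covector_lift (flag N) I \<gamma>' (\<lambda>t. coord_vec 0 - \<gamma> t $ coord 1 *\<^sub>R coord_vec 4)"
  unfolding covector_lift_def
proof (intro conjI ballI)
  let ?q = "\<lambda>t. coord_vec 0 - \<gamma> t $ coord 1 *\<^sub>R coord_vec 4 :: real^'n"
  have q: "?q t \<bullet> v = v $ coord 0 - \<gamma> t $ coord 1 * v $ coord 4" for t v
    by (simp add: inner_diff_left inner_commute[of "coord_vec _"] inner_coord_vec)
  show "?q t \<noteq> 0" if "t \<in> I" for t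
  proof
    assume "?q t = 0"
    then have "?q t $ coord 0 = 0" by simp
    then show False using card by (simp add: coord_vec_nth)
  qed
  show "loc_abs_cont I ?q"
  proof (rule loc_abs_cont_mono[OF I(3)])
    fix s t
    have "?q s - ?q t = - ((\<gamma> s - \<gamma> t) $ coord 1 *\<^sub>R coord_vec 4)" by (simp add: algebra_simps)
    then have "dist (?q s) (?q t) = \<bar>(\<gamma> s - \<gamma> t) $ coord 1\<bar>" by (simp add: dist_norm coord_vec_def)
    also have "\<dots> \<le> dist (\<gamma> s) (\<gamma> t)" unfolding dist_norm by (rule component_le_norm_cart)
    finally show "dist (?q s) (?q t) \<le> dist (\<gamma> s) (\<gamma> t)" .
  qed
  fix t0 assume "t0 \<in> I"
  then obtain S k f r u where fr: "local_frame (flag N) S k f" and r: "0 < r"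
    and S: "\<forall>t \<in> I \<inter> ball t0 r. \<gamma> t \<in> S"
    and u: "\<forall>i<k. (\<lambda>t. u t i) \<in> borel_measurable (lebesgue_on (I \<inter> ball t0 r))"
    and h: "hamilton_eqs k f (I \<inter> ball t0 r) \<gamma> p u"
    using l unfolding covector_lift_def by blast
  let ?J = "I \<inter> ball t0 r"
  define X where "X t = (\<Sum>i<k. u t i *\<^sub>R f i (\<gamma> t))" for t
  \<comment> \<open>The controls in the standard frame; the one belonging to \<open>total_r N\<close> vanishes almost everywhere
    anyway, and with zero everywhere the Hamiltonian does not depend on the point.\<close>
  define u' where "u' t i = (if i = 0 then 0 else X t $ coord (N + i))" for t and i :: nat
  have meas: "(\<lambda>t. u' t i) \<in> borel_measurable (lebesgue_on ?J)" for i
  proof -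
    have "(\<lambda>t. f j (\<gamma> t) $ coord (N + i)) \<in> borel_measurable (lebesgue_on ?J)" if "j < k" for j
    proof (rule continuous_imp_measurable_on_sets_lebesgue[OF _ lebesgue_interval_ball[OF I(1)]])
      have "continuous_on S (f j)"
        using fr that by (intro smooth_on_imp_continuous_on) (simp add: local_frame_def)
      then show "continuous_on ?J (\<lambda>t. f j (\<gamma> t) $ coord (N + i))"
        using S I(2) by (intro continuous_intros) (auto intro: continuous_on_compose2 continuous_on_subset)
    qed
    then have "(\<lambda>t. \<Sum>j<k. u t j * f j (\<gamma> t) $ coord (N + i)) \<in> borel_measurable (lebesgue_on ?J)"
      using u by (intro borel_measurable_sum borel_measurable_times) auto
    then show ?thesis by (cases "i = 0") (simp_all add: u'_def X_def)
  qed
  have frame: "(\<Sum>i<CARD('n) - N. u' t i *\<^sub>R std_frame N i y) = (\<Sum>k\<in>{N<..<CARD('n)}. X t $ coord k *\<^sub>R coord_vec k)" for t y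
  proof -
    have "(\<Sum>i<CARD('n) - N. u' t i *\<^sub>R std_frame N i y) = (\<Sum>i\<in>{0<..<CARD('n) - N}. X t $ coord (N + i) *\<^sub>R coord_vec (N + i))"
      by (rule sum.mono_neutral_cong_right) (auto simp: u'_def std_frame_def)
    also have "\<dots> = (\<Sum>k\<in>{N<..<CARD('n)}. X t $ coord k *\<^sub>R coord_vec k)"
      by (rule sum.reindex_bij_witness[of _ "\<lambda>k. k - N" "\<lambda>i. N + i"]) auto
    finally show ?thesis .
  qed
  have "AE t in lebesgue. t \<in> ?J \<longrightarrow> X t \<in> flag N (\<gamma> t) \<and> X t $ coord 3 = 0"
    unfolding X_def
    by (rule abnormal_velocity_3_zero[OF N fr _ _ _ h]) (use S reg l in \<open>auto simp: covector_lift_def\<close>)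
  then have ham: "hamilton_eqs (CARD('n) - N) (std_frame N) ?J \<gamma>' ?q u'"
    using h unfolding hamilton_eqs_alt
  proof (eventually_elim, intro impI)
    case (elim t)
    assume t: "t \<in> ?J"
    then have X: "X t \<in> flag N (\<gamma> t)" "X t $ coord 3 = 0" using elim by auto
    have v: "(\<gamma> has_vector_derivative X t) (at t within ?J)" using elim t by (simp add: X_def)
    then have "((\<lambda>t. \<gamma> t + s *\<^sub>R coord_vec 8) has_vector_derivative X t) (at t within ?J)"
      by (auto intro!: derivative_eq_intros)
    then have v': "(\<gamma>' has_vector_derivative X t) (at t within ?J)"
      by (rule has_vector_derivative_transform[OF t, rotated]) (use \<gamma>' in auto)
    have e: "X t = (\<Sum>k\<in>{N<..<CARD('n)}. X t $ coord k *\<^sub>R coord_vec k)"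
      using flag_expansion[OF card _ N(2) X(1)] X(2) N by simp
    have "((\<lambda>t. coord_vec 0 - \<gamma> t $ coord 1 *\<^sub>R coord_vec 4) has_vector_derivative - (X t $ coord 1 *\<^sub>R coord_vec 4)) (at t within ?J)"
      using bounded_linear.has_vector_derivative[OF bounded_linear_vec_nth v, of "coord 1"]
      by (auto intro!: derivative_eq_intros simp: has_real_derivative_iff_has_vector_derivative)
    moreover have "X t $ coord 1 = 0" using flag_components(2)[OF N(1) X(1)] X(2) by simp
    ultimately have dq: "(?q has_vector_derivative 0) (at t within ?J)" by simp
    have dH: "((\<lambda>y. ?q t \<bullet> (\<Sum>i<CARD('n) - N. u' t i *\<^sub>R std_frame N i y)) has_derivative (\<lambda>v. - (v \<bullet> 0))) (at (\<gamma>' t))"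
      unfolding frame by simp
    have ctrl: "?q t \<bullet> std_frame N j (\<gamma>' t) = 0" if "j < CARD('n) - N" for j
      using that N card t \<gamma>' unfolding q by (auto simp: std_frame_def total_r_nth[OF card] coord_vec_nth)
    show "(\<gamma>' has_vector_derivative (\<Sum>i<CARD('n) - N. u' t i *\<^sub>R std_frame N i (\<gamma>' t))) (at t within ?J) \<and>
     (\<exists>p'. (?q has_vector_derivative p') (at t within ?J) \<and>
       ((\<lambda>y. ?q t \<bullet> (\<Sum>i<CARD('n) - N. u' t i *\<^sub>R std_frame N i y)) has_derivative (\<lambda>v. - (v \<bullet> p'))) (at (\<gamma>' t))) \<and>
     (\<forall>j<CARD('n) - N. ?q t \<bullet> std_frame N j (\<gamma>' t) = 0)"
      using v' dq dH ctrl unfolding frame e[symmetric] by blast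
  qed
  have "local_frame (flag N) (UNIV :: (real^'n) set) (CARD('n) - N) (std_frame N)"
    using N by (intro local_frame_std_frame[OF card]) auto
  then show "\<exists>S k f r u. local_frame (flag N) S k f \<and> 0 < r \<and> (\<forall>t \<in> I \<inter> ball t0 r. \<gamma>' t \<in> S) \<and>
        (\<forall>i<k. (\<lambda>t. u t i) \<in> borel_measurable (lebesgue_on (I \<inter> ball t0 r))) \<and>
        hamilton_eqs k f (I \<inter> ball t0 r) \<gamma>' ?q u"
    using r meas ham by (intro exI[of _ UNIV] exI[of _ "CARD('n) - N"] exI[of _ "std_frame N"] exI[of _ r] exI[of _ u']) auto
qed

lemma abnormal_curve_shift:
  assumes a: "abnormal_curve coord_space (derived_flag jet_distr i) I \<gamma>"
    and reg: "\<And>t. t \<in> I \<Longrightarrow> 0 < \<gamma> t $ coord 7"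
    and \<gamma>': "\<And>t. t \<in> I \<Longrightarrow> \<gamma>' t = \<gamma> t + s *\<^sub>R (coord_vec 8 :: real^'n)"
  shows "abnormal_curve coord_space (derived_flag jet_distr i) I \<gamma>'"
proof -
  let ?N = "CARD('n) - 2 - i"
  have I: "is_interval I" "interior I \<noteq> {}" "continuous_on I \<gamma>" "loc_abs_cont I \<gamma>"
    and "\<exists>p. covector_lift (flag ?N) I \<gamma> p"
    using a by (auto simp: abnormal_curve_coord_space derived_flag_jet_distr[OF card])
  then obtain p where p: "covector_lift (flag ?N) I \<gamma> p" by blast
  have "\<exists>p. covector_lift (flag ?N) I \<gamma>' p"
  proof (cases "?N \<le> 6")
    case True
    then show ?thesis using covector_lift_translate[OF card True p \<gamma>'] by blast
  next
    case False
    then have "7 \<le> ?N" "?N \<le> CARD('n) - 2" by simp_all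
    then show ?thesis using covector_lift_shift_vertical[OF _ _ I(1,3,4) reg p \<gamma>'] by blast
  qed
  moreover have "continuous_on I \<gamma>'"
    using I(3) by (subst continuous_on_cong[OF refl \<gamma>']) (auto intro: continuous_intros)
  moreover have "loc_abs_cont I \<gamma>'"
    by (rule loc_abs_cont_mono[OF I(4)]) (simp add: \<gamma>')
  ultimately show ?thesis using I by (simp add: abnormal_curve_coord_space derived_flag_jet_distr[OF card])
qed

end


section \<open>Local symmetries\<close>

lemma lie_bracket_const: "lie_bracket (\<lambda>y. a) Y x = frechet_derivative Y (at x) a"
  using frechet_derivative_at[OF has_derivative_const[of a "at x"]]
  by (simp add: lie_bracket_def fun_eq_iff)

lemma linear_frechet_derivative_on: "smooth_on U f \<Longrightarrow> x \<in> U \<Longrightarrow> linear (frechet_derivative f (at x))"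
  by (intro linear_frechet_derivative smooth_on_imp_differentiable)

lemma dirder_mult:
  "smooth_on U f \<Longrightarrow> smooth_on U g \<Longrightarrow> x \<in> U \<Longrightarrow>
    dirder X (\<lambda>x. f x * g x) x = f x * dirder X g x + dirder X f x * g x"
  unfolding dirder_def by (rule frechet_derivative_mult) (erule (1) smooth_on_imp_differentiable)+

lemma dirder_add:
  "smooth_on U f \<Longrightarrow> smooth_on U g \<Longrightarrow> x \<in> U \<Longrightarrow>
    dirder X (\<lambda>x. f x + g x) x = dirder X f x + dirder X g x"
  unfolding dirder_def by (rule frechet_derivative_add) (erule (1) smooth_on_imp_differentiable)+

lemma dirder_nth: "dirder X (\<lambda>x. x $ i) x = X x $ i"
  by (simp add: dirder_def frechet_derivative_at[OF has_derivative_nth, symmetric])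

context
  assumes card: "9 \<le> CARD('n::finite)"
begin

lemma bracket_coord_vec_total_x:
  assumes "l < CARD('n)" "l = 0 \<or> N < l" "N \<le> 3"
  shows "lie_bracket (\<lambda>y. coord_vec l) (total_x N) (x :: real^'n) = 0"
proof -
  have "(\<Sum>j<N. (coord_vec l :: real^'n) $ coord (Suc j) *\<^sub>R (coord_vec j :: real^'n)) = 0"
    using assms card by (intro sum.neutral) (auto simp: coord_vec_nth)
  then show ?thesis
    by (simp add: lie_bracket_const frechet_derivative_at[OF total_x_has_derivative, symmetric])
qed

lemma bracket_coord_vec_coord_vec: "lie_bracket (\<lambda>y. coord_vec l) (\<lambda>y. coord_vec k) (x :: real^'n) = 0"
  using frechet_derivative_at[OF has_derivative_const[of "coord_vec k :: real^'n" "at x"]]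
  by (simp add: lie_bracket_const fun_eq_iff)

lemma flag_expansion_total_x:
  assumes N: "N \<le> 3" and v: "v \<in> flag N (x :: real^'n)"
  shows "v = v $ coord 4 *\<^sub>R total_x N x + (\<Sum>k\<in>{N..<CARD('n)} - {4}. v $ coord k *\<^sub>R coord_vec k)"
proof (rule vec_eq_coordI)
  fix l assume l: "l < CARD('n)"
  have f: "form j x v = 0" if "j < N" for j using v that by (auto simp: flag_def)
  have s: "(\<Sum>k\<in>{N..<CARD('n)} - {4}. v $ coord k *\<^sub>R (coord_vec k :: real^'n)) $ coord l
      = (if l \<in> {N..<CARD('n)} - {4} then v $ coord l else 0)"
    using l by (subst sum_coord_vec_nth) auto
  show "v $ coord l = (v $ coord 4 *\<^sub>R total_x N x + (\<Sum>k\<in>{N..<CARD('n)} - {4}. v $ coord k *\<^sub>R coord_vec k)) $ coord l"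
    unfolding vector_add_component s
    using f[of l] N l by (auto simp: total_x_nth[OF card] form_def form_lead_def form_base_def)
qed

context
  fixes \<psi> :: "real^'n \<Rightarrow> real^'n" and U :: "(real^'n) set"
  assumes U: "open U" and smooth: "smooth_on U \<psi>"
    and inj: "\<And>x. x \<in> U \<Longrightarrow> inj (frechet_derivative \<psi> (at x))"
    and D: "\<And>x v. x \<in> U \<Longrightarrow> v \<in> flag (CARD('n) - 2) x \<Longrightarrow>
      frechet_derivative \<psi> (at x) v \<in> flag (CARD('n) - 2) (\<psi> x)"
begin

lemma linear_differential: "x \<in> U \<Longrightarrow> linear (frechet_derivative \<psi> (at x))"
  by (rule linear_frechet_derivative_on[OF smooth])

text \<open>
  The members of the derived flag are generated by brackets, and \<open>form_bracket_zero\<close> shows that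
  the differential maps brackets of sections of one member into the next one.
\<close>

lemma flag_preserved:
  assumes "N \<le> CARD('n) - 2"
  shows "x \<in> U \<Longrightarrow> v \<in> flag N x \<Longrightarrow> frechet_derivative \<psi> (at x) v \<in> flag N (\<psi> x)"
  using assms
proof (induction arbitrary: x v rule: inc_induct)
  case base
  then show ?case by (rule D)
next
  case (step N)
  let ?d = "frechet_derivative \<psi> (at x)"
  have "v \<in> derived_on UNIV (flag (Suc N)) x"
    using step.prems step.hyps by (simp add: derived_on_flag[OF card])
  moreover have "derived_on UNIV (flag (Suc N)) x \<subseteq> {v. ?d v \<in> flag N (\<psi> x)}"
    unfolding derived_on_def
  proof (rule span_minimal)
    show "subspace {v. ?d v \<in> flag N (\<psi> x)}"
        by (rule linear_subspace_vimage[OF linear_differential[OF step.prems(1)] subspace_flag, unfolded vimage_def])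
    show "flag (Suc N) x \<union> {lie_bracket X Y x | X Y S. open S \<and> x \<in> S \<and> S \<subseteq> UNIV \<and> smooth_on S X \<and>
        smooth_on S Y \<and> (\<forall>y\<in>S. X y \<in> flag (Suc N) y \<and> Y y \<in> flag (Suc N) y)} \<subseteq> {v. ?d v \<in> flag N (\<psi> x)}"
    proof (rule Un_least)
      show "flag (Suc N) x \<subseteq> {v. ?d v \<in> flag N (\<psi> x)}"
        using step.IH[OF step.prems(1)] flag_mono[of N "Suc N" "\<psi> x"] by auto
      show "{lie_bracket X Y x | X Y S. open S \<and> x \<in> S \<and> S \<subseteq> UNIV \<and> smooth_on S X \<and>
        smooth_on S Y \<and> (\<forall>y\<in>S. X y \<in> flag (Suc N) y \<and> Y y \<in> flag (Suc N) y)} \<subseteq> {v. ?d v \<in> flag N (\<psi> x)}"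
      proof clarify
        fix X Y S
        assume S: "open S" "x \<in> S" "smooth_on S X" "smooth_on S Y"
          "\<forall>y\<in>S. X y \<in> flag (Suc N) y \<and> Y y \<in> flag (Suc N) y"
        have "?d (lie_bracket X Y x) \<in> flag (Suc N - 1) (\<psi> x)"
        proof (rule form_bracket_zero[of "S \<inter> U"])
          show "open (S \<inter> U)" "x \<in> S \<inter> U" using S U step.prems by auto
          show "smooth_on (S \<inter> U) \<psi>" by (rule smooth_on_subset[OF smooth]) simp
          show "X differentiable at x" "Y differentiable at x"
            using S smooth_on_imp_differentiable by auto
        qed (use S step.IH in auto)
        then show "?d (lie_bracket X Y x) \<in> flag N (\<psi> x)" by simp
      qed
    qed
  qed
  ultimately show ?case by auto
qed

lemma flag_onto:
  assumes "N \<le> CARD('n) - 2" "x \<in> U" "y \<in> flag N (\<psi> x)"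
  obtains v where "v \<in> flag N x" "frechet_derivative \<psi> (at x) v = y"
proof -
  let ?d = "frechet_derivative \<psi> (at x)"
  have "dim (?d ` flag N x) = dim (flag N x)"
    by (rule dim_image_eq[OF linear_differential[OF assms(2)]]) (rule inj_on_subset[OF inj[OF assms(2)]], simp)
  then have le: "dim (flag N (\<psi> x)) \<le> dim (?d ` flag N x)"
    using assms(1) by (simp add: dim_flag[OF card])
  have "?d ` flag N x = flag N (\<psi> x)"
    by (rule subspace_dim_equal[OF linear_subspace_image[OF linear_differential[OF assms(2)] subspace_flag] subspace_flag _ le])
      (use flag_preserved[OF assms(1,2)] in blast)
  then obtain v where "v \<in> flag N x" "?d v = y" using assms(3) by (metis imageE)
  then show ?thesis by (rule that)
qed

text \<open>
  For these \<open>l\<close> the direction \<open>coord_vec l\<close> is a Cauchy characteristic of \<open>flag N\<close>: its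
  brackets with a frame vanish. Hence so does the exterior derivative of the pulled back form
  \<open>form (N - 1)\<close> on this direction and any vector of \<open>flag N\<close>. This formulation is bilinear in
  the two vectors, and the fields need not be transported by the symmetry.
\<close>

lemma characteristic_relation:
  assumes N: "1 \<le> N" "N \<le> 2" and l: "N < l" "l < CARD('n)" "l \<noteq> 4" and x: "x \<in> U" and b: "b \<in> flag N x"
  shows "frechet_derivative \<psi> (at x) (coord_vec l) $ coord N * frechet_derivative \<psi> (at x) b $ coord 4
    = frechet_derivative \<psi> (at x) b $ coord N * frechet_derivative \<psi> (at x) (coord_vec l) $ coord 4"
proof -
  let ?d = "frechet_derivative \<psi> (at x)"
  obtain j where j: "N = Suc j" "j < 2" using N by (cases N) auto
  define L where "L v = ?d (coord_vec l) $ coord N * ?d v $ coord 4 - ?d v $ coord N * ?d (coord_vec l) $ coord 4" for v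
  have linL: "linear L"
    using linear_differential[OF x] by (intro linearI) (simp_all add: L_def linear_add linear_cmul algebra_simps)
  have L: "L (Y x) = 0"
    if Y: "smooth_on UNIV Y" "\<And>y. Y y \<in> flag N y" and br: "lie_bracket (\<lambda>y. coord_vec l) Y x = 0" for Y
  proof -
    have "form j (\<psi> y) (frechet_derivative \<psi> (at y) v) = 0" if "y \<in> U" "v \<in> flag N y" for y v
      using flag_preserved[of N y v] N that j card by (auto simp: flag_def)
    moreover have "coord_vec l \<in> flag N y" for y :: "real^'n" using l N by (intro coord_vec_in_flag[OF card]) auto
    ultimately have "form j (\<psi> x) (?d (lie_bracket (\<lambda>y. coord_vec l) Y x)) =
      ?d (coord_vec l) $ coord (Suc (form_lead j)) * ?d (Y x) $ coord (form_base j) - ?d (Y x) $ coord (Suc (form_lead j)) * ?d (coord_vec l) $ coord (form_base j)"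
      using Y by (intro form_bracket[OF U x smooth]) (auto intro: smooth_on_imp_differentiable)
    then show ?thesis
      using j br linear_0[OF linear_differential[OF x]] linear_0[OF linear_form, of j "\<psi> x"]
      by (simp add: L_def form_lead_def form_base_def)
  qed
  have "L (total_x N x) = 0"
    using l N by (intro L smooth_total_x total_x_in_flag[OF card] bracket_coord_vec_total_x) auto
  moreover have "L (coord_vec k) = 0" if "k \<in> {N..<CARD('n)} - {4}" for k
    by (rule L) (use that N in \<open>auto intro: smooth_intros coord_vec_in_flag[OF card] bracket_coord_vec_coord_vec\<close>)
  ultimately have "L (b $ coord 4 *\<^sub>R total_x N x + (\<Sum>k\<in>{N..<CARD('n)} - {4}. b $ coord k *\<^sub>R coord_vec k)) = 0"
    using linL by (simp add: linear_add linear_cmul linear_sum)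
  then have "L b = 0" using flag_expansion_total_x[OF _ b] N by simp
  then show ?thesis by (simp add: L_def)
qed

text \<open>
  The relation for \<open>N = 1\<close>, with a vector mapped to \<open>coord_vec 1\<close>.
\<close>

lemma component_4_vertical:
  assumes l: "2 \<le> l" "l < CARD('n)" "l \<noteq> 4" and x: "x \<in> U"
  shows "frechet_derivative \<psi> (at x) (coord_vec l) $ coord 4 = 0"
proof -
  have ax1: "coord_vec 1 \<in> flag 1 (\<psi> x)" using card by (intro coord_vec_in_flag[OF card]) auto
  obtain b where b: "b \<in> flag 1 x" "frechet_derivative \<psi> (at x) b = coord_vec 1"
    by (rule flag_onto[OF _ x ax1]) (use card in auto)
  show ?thesis
    using characteristic_relation[of 1 l x b] l x b card by (simp add: coord_vec_nth)
qed

lemma component_4_transversal: 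
  assumes x: "x \<in> U"
  obtains b where "b \<in> flag 2 x" "frechet_derivative \<psi> (at x) b $ coord 4 = 1"
proof -
  obtain b where "b \<in> flag 2 x" "frechet_derivative \<psi> (at x) b = total_x 2 (\<psi> x)"
    by (rule flag_onto[OF _ x total_x_in_flag[OF card, of 2]]) (use card in auto)
  then show ?thesis using that card by (simp add: total_x_nth[OF card])
qed

text \<open>
  The relation for \<open>N = 2\<close>. The direction \<open>coord_vec 2\<close> is excluded: it is characteristic for
  \<open>flag 1\<close> but not for \<open>flag 2\<close>.
\<close>

lemma component_2_vertical:
  assumes l: "3 \<le> l" "l < CARD('n)" "l \<noteq> 4" and x: "x \<in> U"
  shows "frechet_derivative \<psi> (at x) (coord_vec l) $ coord 2 = 0"
proof -
  obtain b where b: "b \<in> flag 2 x" "frechet_derivative \<psi> (at x) b $ coord 4 = 1"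
    by (rule component_4_transversal[OF x])
  show ?thesis
    using characteristic_relation[of 2 l x b] component_4_vertical[of l x] l x b by simp
qed

text \<open>
  Otherwise the component \<open>z4\<close> of the symmetry would have derivative zero on all of \<open>flag 2\<close>.
\<close>

lemma component_4_total_x:
  assumes x: "x \<in> U" shows "frechet_derivative \<psi> (at x) (total_x 2 x) $ coord 4 \<noteq> 0"
proof
  let ?d = "\<lambda>v. frechet_derivative \<psi> (at x) v $ coord 4"
  assume 0: "?d (total_x 2 x) = 0"
  obtain b where b: "b \<in> flag 2 x" "?d b = 1" by (rule component_4_transversal[OF x])
  have "?d (b $ coord 4 *\<^sub>R total_x 2 x + (\<Sum>k\<in>{2..<CARD('n)} - {4}. b $ coord k *\<^sub>R coord_vec k)) = 0"
    using 0 component_4_vertical[OF _ _ _ x] linear_differential[OF x]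
    by (simp add: linear_add linear_cmul linear_sum)
  then show False using flag_expansion_total_x[OF _ b(1)] b(2) by simp
qed

text \<open>
  Such a function depends on \<open>z0, z1, z2, z4\<close> only. The factor \<open>z5\<close> has order two along the
  integral curve, so that the function is constant up to terms of order three there.
\<close>

lemma dirder_total_r:
  assumes f: "smooth_on U f" and x: "x \<in> U"
    and b: "\<And>l. l < CARD('n) \<Longrightarrow> 3 \<le> l \<Longrightarrow> l \<noteq> 4 \<Longrightarrow> frechet_derivative f (at x) (coord_vec l) = 0"
  shows "dirder (total_r (CARD('n) - 2)) f x = x $ coord 5 * dirder (total_x 3) f x"
proof -
  note L = linear_frechet_derivative_on[OF f x]
  have "(\<Sum>k=5..CARD('n) - 2. x $ coord (Suc k) * frechet_derivative f (at x) (coord_vec k)) = 0"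
    using b by (intro sum.neutral) auto
  then show ?thesis
    using b[of 3] card unfolding dirder_def total_r_def
    by (simp add: linear_add[OF L] linear_cmul[OF L] linear_sum[OF L])
qed

lemma dirder_constant_along:
  assumes f: "smooth_on U f" and Y: "smooth_on UNIV Y"
    and b: "\<And>y. y \<in> U \<Longrightarrow> frechet_derivative f (at y) (coord_vec l) = 0"
    and br: "\<And>y. lie_bracket (\<lambda>y. coord_vec l) Y y = 0" and x: "x \<in> U"
  shows "frechet_derivative (dirder Y f) (at x) (coord_vec l) = 0"
proof -
  have "dirder Y (dirder (\<lambda>y. coord_vec l) f) x = dirder Y (\<lambda>y. 0) x"
    by (rule dirder_cong[OF U x]) (simp add: dirder_def b)
  also have "\<dots> = 0"
    using frechet_derivative_at[OF has_derivative_const[of 0 "at x"]] by (simp add: dirder_def fun_eq_iff)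
  finally show ?thesis
    using dirder_commutator[OF U x f, of "\<lambda>y. coord_vec l" Y] br[of x] smooth_on_imp_differentiable[OF Y]
      linear_0[OF linear_frechet_derivative_on[OF f x]]
    by (simp add: dirder_def[of "\<lambda>y. coord_vec l" "dirder Y f"])
qed

text \<open>
  Expansion in powers of the parameter along the integral curve of \<open>total_r\<close> is replaced by
  repeated differentiation \<open>d\<close> in its direction. With \<open>c k\<close> the components of the symmetry, \<open>h\<close>,
  \<open>g\<close> and \<open>m\<close> have vanishing first and second derivatives at the point. Hence two
  differentiations of \<open>c 3 h = g + z3 m\<close> give \<open>d (d (c 3)) = 0\<close>, and two and three
  differentiations of \<open>c 5 a = z5 h\<close> with \<open>a = d (c 3)\<close> give \<open>a^3 = h\<close> and \<open>c 8 a^4 = 0\<close>. As \<open>h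
  \<noteq> 0\<close>, this is incompatible with \<open>c 8 = 1\<close>.
\<close>

lemma no_equivalence:
  assumes x: "x \<in> U"
    and 1: "x $ coord 3 = 0" "x $ coord 5 = 0" "x $ coord 6 = 0" "x $ coord 7 = 1" "x $ coord 8 = 0"
    and 2: "\<psi> x $ coord 3 = 0" "\<psi> x $ coord 5 = 0" "\<psi> x $ coord 6 = 0" "\<psi> x $ coord 7 = 1" "\<psi> x $ coord 8 = 1"
  shows False
proof -
  let ?M = "CARD('n) - 2"
  define c where "c k y = \<psi> y $ coord k" for k y
  define z where "z k y = y $ coord k" for k and y :: "real^'n"
  define d where "d = dirder (total_r ?M :: real^'n \<Rightarrow> _)"
  define h where "h = dirder (total_x 2) (c 4)"
  define g where "g = dirder (total_x 2) (c 2)"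
  define m where "m = dirder (\<lambda>y. coord_vec 2) (c 2)"
  define a where "a = d (c 3)"
  have sm: "smooth_on U (c k)" "smooth_on U (z k)" for k
    unfolding c_def[abs_def] z_def[abs_def] by (intro smooth_intros U smooth)+
  have sW: "smooth_on U (total_x N)" "smooth_on U (total_r N)" for N
    using smooth_on_subset[OF smooth_total_x] smooth_on_subset[OF smooth_total_r] by auto
  have sd: "smooth_on U (d f)" if "smooth_on U f" for f
    unfolding d_def by (intro smooth_intros U sW that)
  have sh: "smooth_on U h" "smooth_on U g" "smooth_on U m" "smooth_on U a"
    unfolding h_def g_def m_def a_def by (intro smooth_intros U sW sm sd)+
  note sms = sm sd sh smooth_on_mult[OF U] smooth_on_add[OF U] smooth_on_const
  have dconst: "d (\<lambda>y. r) y = 0" for r y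
    by (simp add: d_def dirder_def frechet_derivative_at[OF has_derivative_const, symmetric])
  have dmult: "d (\<lambda>y. f y * k y) y = f y * d k y + d f y * k y"
    if "smooth_on U f" "smooth_on U k" "y \<in> U" for f k y
    unfolding d_def using that by (rule dirder_mult)
  have dadd: "d (\<lambda>y. f y + k y) y = d f y + d k y"
    if "smooth_on U f" "smooth_on U k" "y \<in> U" for f k y
    unfolding d_def using that by (rule dirder_add)
  have dcong: "d f y = d k y" if "\<And>y. y \<in> U \<Longrightarrow> f y = k y" "y \<in> U" for f k y
    unfolding d_def by (rule dirder_cong[OF U that(2)]) (rule that(1))
  have comp_deriv: "frechet_derivative (c k) (at y) v = frechet_derivative \<psi> (at y) v $ coord k" if "y \<in> U" for k y v
    unfolding c_def[abs_def] by (rule frechet_derivative_nth) (rule smooth_on_imp_differentiable[OF smooth that])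
  have dz: "d (z 3) y = 1" "d (z 5) y = z 6 y" "d (z 6) y = z 7 y" "d (z 7) y = z 8 y" for y
    using card unfolding d_def z_def[abs_def] by (simp_all add: dirder_nth total_r_nth[OF card])
  have pV: "frechet_derivative \<psi> (at y) (total_r ?M y) \<in> flag ?M (\<psi> y)" if "y \<in> U" for y
    using that by (intro D total_r_in_flag[OF card]) auto
  have dc: "d (c 4) y = c 5 y * a y" "d (c 5) y = c 6 y * a y" "d (c 6) y = c 7 y * a y" "d (c 7) y = c 8 y * a y"
    if "y \<in> U" for y
  proof -
    have f: "form j (\<psi> y) (frechet_derivative \<psi> (at y) (total_r ?M y)) = 0" if "j < 7" for j
      using pV[OF \<open>y \<in> U\<close>] that card by (auto simp: flag_def)
    show "d (c 4) y = c 5 y * a y" "d (c 5) y = c 6 y * a y" "d (c 6) y = c 7 y * a y" "d (c 7) y = c 8 y * a y"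
      using f[of 3] f[of 4] f[of 5] f[of 6]
      by (simp_all add: a_def d_def dirder_def comp_deriv[OF that] form_def form_lead_def form_base_def c_def)
  qed
  have W3: "total_x 3 y = total_x 2 y + y $ coord 3 *\<^sub>R coord_vec 2" for y :: "real^'n"
    by (simp add: total_x_def eval_nat_numeral)
  have b4: "frechet_derivative (c 4) (at y) (coord_vec l) = 0" if "y \<in> U" "l < CARD('n)" "2 \<le> l" "l \<noteq> 4" for y l
    using that by (simp add: comp_deriv component_4_vertical)
  have b2: "frechet_derivative (c 2) (at y) (coord_vec l) = 0" if "y \<in> U" "l < CARD('n)" "3 \<le> l" "l \<noteq> 4" for y l
    using that by (simp add: comp_deriv component_2_vertical)
  have c4W3: "dirder (total_x 3) (c 4) y = h y" if y: "y \<in> U" for y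
    using b4[OF y, of 2] card unfolding h_def dirder_def W3
    by (simp add: linear_add[OF linear_frechet_derivative_on[OF sm(1) y]]
        linear_cmul[OF linear_frechet_derivative_on[OF sm(1) y]])
  have R1: "g y + z 3 y * m y = c 3 y * h y" if y: "y \<in> U" for y
  proof -
    have "frechet_derivative \<psi> (at y) (total_x 3 y) \<in> flag 3 (\<psi> y)"
      using y card by (intro flag_preserved total_x_in_flag[OF card]) auto
    then have "form 2 (\<psi> y) (frechet_derivative \<psi> (at y) (total_x 3 y)) = 0" by (simp add: flag_def)
    then have "dirder (total_x 3) (c 2) y = c 3 y * dirder (total_x 3) (c 4) y"
      by (simp add: dirder_def comp_deriv[OF y] form_def form_lead_def form_base_def c_def numeral_3_eq_3)
    moreover have "dirder (total_x 3) (c 2) y = g y + z 3 y * m y"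
      unfolding g_def m_def dirder_def W3
      by (simp add: linear_add[OF linear_frechet_derivative_on[OF sm(1) y]]
        linear_cmul[OF linear_frechet_derivative_on[OF sm(1) y]] z_def)
    ultimately show ?thesis using c4W3[OF y] by simp
  qed
  have R2: "c 5 y * a y = z 5 y * h y" if y: "y \<in> U" for y
    using dirder_total_r[OF sm(1)[of 4] y] b4[OF y] c4W3[OF y] dc(1)[OF y]
    by (simp add: d_def z_def)
  have basic: "d f x = 0" "d (d f) x = 0"
    if f: "smooth_on U f" and b: "\<And>l y. l < CARD('n) \<Longrightarrow> 3 \<le> l \<Longrightarrow> l \<noteq> 4 \<Longrightarrow> y \<in> U \<Longrightarrow>
      frechet_derivative f (at y) (coord_vec l) = 0" for f
  proof -
    have df: "d f y = z 5 y * dirder (total_x 3) f y" if "y \<in> U" for y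
      unfolding d_def z_def using f that b by (intro dirder_total_r) auto
    show "d f x = 0" using df[OF x] 1 by (simp add: z_def)
    have s: "smooth_on U (dirder (total_x 3) f)" by (intro smooth_intros U sW f)
    have "d (d f) x = d (\<lambda>y. z 5 y * dirder (total_x 3) f y) x" using df x by (intro dcong)
    also have "\<dots> = 0" using 1 by (subst dmult[OF sm(2) s x]) (simp add: dz z_def)
    finally show "d (d f) x = 0" .
  qed
  have ch: "d h x = 0" "d (d h) x = 0"
    unfolding h_def
    by (rule basic; (intro smooth_intros U sW sm)?; intro dirder_constant_along smooth_total_x sm b4 bracket_coord_vec_total_x; simp)+
  have cg: "d g x = 0" "d (d g) x = 0"
    unfolding g_def
    by (rule basic; (intro smooth_intros U sW sm)?; intro dirder_constant_along smooth_total_x sm b2 bracket_coord_vec_total_x; simp)+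
  have cm: "d m x = 0" "d (d m) x = 0"
    unfolding m_def
    by (rule basic; (intro smooth_intros U sW sm)?; intro dirder_constant_along smooth_on_const sm b2 bracket_coord_vec_coord_vec; simp)+
  have vals: "z 3 x = 0" "z 5 x = 0" "z 6 x = 0" "z 7 x = 1" "z 8 x = 0"
    "c 3 x = 0" "c 5 x = 0" "c 6 x = 0" "c 7 x = 1" "c 8 x = 1"
    using 1 2 by (simp_all add: z_def c_def)
  \<comment> \<open>The derivatives of \<open>R1\<close>, the second one at \<open>x\<close> only.\<close>
  have G1: "d g y + (z 3 y * d m y + m y) = c 3 y * d h y + a y * h y" if y: "y \<in> U" for y
    using dcong[of "\<lambda>y. g y + z 3 y * m y" "\<lambda>y. c 3 y * h y", OF R1 y] y
    by (simp add: dmult dadd sms dz a_def)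
  have G2: "d a x * h x = 0"
    using dcong[of "\<lambda>y. d g y + (z 3 y * d m y + m y)" "\<lambda>y. c 3 y * d h y + a y * h y", OF G1 x] x
    by (simp add: dmult dadd sms dz a_def[symmetric] vals cg cm ch)
  \<comment> \<open>The derivatives of \<open>R2\<close>, the third one at \<open>x\<close> only, in the last step.\<close>
  have F1: "c 5 y * d a y + c 6 y * a y * a y = z 5 y * d h y + z 6 y * h y" if y: "y \<in> U" for y
    using dcong[of "\<lambda>y. c 5 y * a y" "\<lambda>y. z 5 y * h y", OF R2 y] y by (simp add: dmult dadd sms dz dc)
  have F2: "c 5 y * d (d a) y + c 6 y * a y * d a y + (c 6 y * a y * d a y + (c 6 y * d a y + c 7 y * a y * a y) * a y)
    = z 5 y * d (d h) y + z 6 y * d h y + (z 6 y * d h y + z 7 y * h y)" if y: "y \<in> U" for y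
    using dcong[of "\<lambda>y. c 5 y * d a y + c 6 y * a y * a y" "\<lambda>y. z 5 y * d h y + z 6 y * h y", OF F1 y] y
    by (simp add: dmult dadd sms dz dc)
  have a3: "a x ^ 3 = h x"
    using F2[OF x] by (simp add: vals power3_eq_cube)
  have h0: "h x \<noteq> 0"
    using component_4_total_x[OF x] by (simp add: h_def dirder_def comp_deriv[OF x])
  then have da: "d a x = 0" using G2 by simp
  have "a x ^ 4 = 0"
    using dcong[of "\<lambda>y. c 5 y * d (d a) y + c 6 y * a y * d a y
        + (c 6 y * a y * d a y + (c 6 y * d a y + c 7 y * a y * a y) * a y)"
      "\<lambda>y. z 5 y * d (d h) y + z 6 y * d h y + (z 6 y * d h y + z 7 y * h y)", OF F2 x] x
    by (simp add: dmult dadd dconst sms dz dc vals ch da power4_eq_xxxx)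
  then show False using a3 h0 by simp
qed

end

end


section \<open>Two inequivalent points with the same abnormal curves\<close>

text \<open>
  The base point has \<open>z7 = 1\<close> and all other coordinates zero, so its shift by one has in
  addition \<open>z8 = 1\<close>.
\<close>

definition half_space :: "(real^'n) set" where "half_space = {x. 0 < x $ coord 7}"
definition shift :: "real \<Rightarrow> real^'n \<Rightarrow> real^'n" where "shift s x = x + s *\<^sub>R coord_vec 8"
definition base_point :: "real^'n" where "base_point = coord_vec 7"

lemma smooth_manifold_coord_space: "smooth_manifold (coord_space :: (real^'n, 'n::finite) manifold)"
proof -
  have "second_countable (euclidean :: (real^'n) topology)"
  proof -
    obtain \<B> :: "(real^'n) set set" where "countable \<B>" "\<And>C. C \<in> \<B> \<Longrightarrow> open C"
      "\<And>S. open S \<Longrightarrow> \<exists>U. U \<subseteq> \<B> \<and> S = \<Union>U"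
      by (rule univ_second_countable) blast
    then show ?thesis
      unfolding second_countable_def by (intro exI[of _ \<B>]) (simp, blast)
  qed
  moreover have "smooth_on UNIV (id :: real^'n \<Rightarrow> real^'n)"
    using smooth_on_id[of UNIV] by (simp add: id_def)
  ultimately show ?thesis
    by (simp add: smooth_manifold_def smooth_map_def Hausdorff_space_euclidean)
qed

lemma open_half_space: "open half_space"
  unfolding half_space_def by (intro open_Collect_less continuous_intros)

lemma smooth_on_shift: "smooth_on S (shift s)" if "open S"
  unfolding shift_def[abs_def] using that by (intro smooth_intros)

lemma shift_shift [simp]: "shift s (shift t x) = shift (s + t) x" "shift 0 x = x"
  by (simp_all add: shift_def algebra_simps)

context
  assumes card: "9 \<le> CARD('n::finite)"
begin

lemma distribution_jet_distr: "distribution coord_space 2 (jet_distr :: (real^'n, 'n) distr)"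
proof -
  have "local_frame (flag (CARD('n) - 2)) (UNIV :: (real^'n) set) 2 (std_frame (CARD('n) - 2))"
    using local_frame_std_frame[OF card, of "CARD('n) - 2"] card by simp
  then show ?thesis
    by (auto simp: distribution_def pushes_forward_def frechet_derivative_id_fun jet_distr_def)
qed

lemma goursat_jet_distr: "goursat coord_space (jet_distr :: (real^'n, 'n) distr)"
proof -
  have "dim (derived_flag jet_distr i (UNIV, id) (y :: real^'n)) = i + 2" if "i \<le> CARD('n) - 2" for i y
    using that card by (simp add: derived_flag_jet_distr[OF card] dim_flag[OF card])
  then show ?thesis
    using card distribution_jet_distr smooth_manifold_coord_space by (simp add: goursat_def)
qed

lemma shift_half_space [simp]: "shift s x \<in> half_space \<longleftrightarrow> (x :: real^'n) \<in> half_space"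
  using card by (simp add: shift_def half_space_def coord_vec_nth)

lemma bij_shift: "bij_betw (shift s) half_space (half_space :: (real^'n) set)"
  by (rule bij_betw_byWitness[of _ "shift (- s)"]) auto

lemma inv_shift: "x \<in> half_space \<Longrightarrow> inv_into half_space (shift s) x = shift (- s) (x :: real^'n)"
  using bij_shift[of s] by (intro inv_into_f_eq) (auto simp: bij_betw_def)

lemma local_diffeo_shift: "local_diffeo coord_space coord_space half_space half_space (shift s :: real^'n \<Rightarrow> real^'n)"
proof -
  have c: "continuous_on half_space (shift t :: real^'n \<Rightarrow> real^'n)" for t
    by (rule smooth_on_imp_continuous_on[OF smooth_on_shift[OF open_half_space]])
  have "homeomorphic_map (top_of_set half_space) (top_of_set half_space) (shift s :: real^'n \<Rightarrow> real^'n)"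
    unfolding homeomorphic_map_maps homeomorphic_maps_def
    using c by (intro exI[of _ "shift (- s)"]) auto
  moreover have "smooth_on half_space (inv_into half_space (shift s) :: real^'n \<Rightarrow> real^'n)"
    by (rule smooth_on_cong[OF open_half_space _ smooth_on_shift[OF open_half_space, of "- s"]]) (simp add: inv_shift)
  ultimately show ?thesis
    using open_half_space smooth_on_shift[OF open_half_space, of s]
    by (simp add: local_diffeo_def smooth_map_def)
qed

text \<open>
  Outside its parameter interval a curve is arbitrary, and \<open>inv_into\<close> agrees with the inverse
  translation on the half space only; hence \<open>abnormal_curve_shift\<close> relates curves that differ by
  a translation on the interval.
\<close>

lemma transforms_abnormal_curves_shift:
  "transforms_abnormal_curves coord_space jet_distr coord_space jet_distr half_space half_space (shift s :: real^'n \<Rightarrow> real^'n)"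
  unfolding transforms_abnormal_curves_def
proof (intro allI conjI impI)
  fix i I and \<gamma> :: "real \<Rightarrow> real^'n"
  assume r: "\<gamma> ` I \<subseteq> half_space" and a: "abnormal_curve coord_space (derived_flag jet_distr i) I \<gamma>"
  have pos: "0 < \<gamma> t $ coord 7" if "t \<in> I" for t using r that by (auto simp: half_space_def)
  show "abnormal_curve coord_space (derived_flag jet_distr i) I (shift s \<circ> \<gamma>)"
    by (rule abnormal_curve_shift[OF card a pos]) (auto simp: shift_def)
  show "abnormal_curve coord_space (derived_flag jet_distr i) I (inv_into half_space (shift s) \<circ> \<gamma>)"
  proof (rule abnormal_curve_shift[OF card a pos])
    fix t assume "t \<in> I"
    then have "\<gamma> t \<in> half_space" using r by blast
    then show "(inv_into half_space (shift s) \<circ> \<gamma>) t = \<gamma> t + (- s) *\<^sub>R coord_vec 8"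
      by (simp add: inv_shift) (simp add: shift_def)
  qed
qed

lemma not_locally_equivalent:
  "\<not> locally_equivalent coord_space jet_distr (base_point :: real^'n) coord_space jet_distr (shift 1 base_point :: real^'n)"
proof
  assume "locally_equivalent coord_space jet_distr (base_point :: real^'n) coord_space jet_distr (shift 1 base_point :: real^'n)"
  then obtain U U' and \<psi> :: "real^'n \<Rightarrow> real^'n" where ld: "local_diffeo coord_space coord_space U U' \<psi>"
    and p: "base_point \<in> U" "\<psi> base_point = shift 1 base_point" and pf: "pushes_forward coord_space coord_space U \<psi> jet_distr jet_distr"
    unfolding locally_equivalent_def by blast
  have U: "open U" "open U'" and hom: "homeomorphic_map (top_of_set U) (top_of_set U') \<psi>"
    and s: "smooth_on U \<psi>" "smooth_on U' (inv_into U \<psi>)"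
    using ld by (simp_all add: local_diffeo_def smooth_map_def)
  have b: "bij_betw \<psi> U U'"
    using homeomorphic_imp_injective_map[OF hom] homeomorphic_imp_surjective_map[OF hom]
    by (simp add: bij_betw_def)
  have inj: "inj (frechet_derivative \<psi> (at x))" if x: "x \<in> U" for x
  proof -
    let ?g = "inv_into U \<psi>"
    have "\<psi> x \<in> U'" using b x by (auto simp: bij_betw_def)
    then have "(?g has_derivative frechet_derivative ?g (at (\<psi> x))) (at (\<psi> x))"
      using smooth_on_imp_differentiable[OF s(2)] by (simp add: frechet_derivative_works)
    moreover have "(\<psi> has_derivative frechet_derivative \<psi> (at x)) (at x)"
      using smooth_on_imp_differentiable[OF s(1) x] by (simp add: frechet_derivative_works)
    ultimately have "(?g \<circ> \<psi> has_derivative frechet_derivative ?g (at (\<psi> x)) \<circ> frechet_derivative \<psi> (at x)) (at x)"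
      by (intro diff_chain_at)
    then have "((\<lambda>y. y) has_derivative frechet_derivative ?g (at (\<psi> x)) \<circ> frechet_derivative \<psi> (at x)) (at x)"
      by (rule has_derivative_transform_within_open[OF _ U(1) x]) (use b in \<open>auto simp: bij_betw_def\<close>)
    then have "frechet_derivative ?g (at (\<psi> x)) \<circ> frechet_derivative \<psi> (at x) = (\<lambda>v. v)"
      by (rule has_derivative_unique[OF _ has_derivative_ident])
    then show ?thesis by (metis inj_on_imageI2 inj_on_id2)
  qed
  have D: "frechet_derivative \<psi> (at x) v \<in> flag (CARD('n) - 2) (\<psi> x)"
    if "x \<in> U" "v \<in> flag (CARD('n) - 2) x" for x v
    using pf that by (auto simp: pushes_forward_def jet_distr_def)
  have n: "(base_point :: real^'n) $ coord k = (if k = 7 then 1 else 0 :: real)"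
    "\<psi> base_point $ coord k = (if k = 7 \<or> k = 8 then 1 else 0)" if "k \<le> 8" for k
    using that card unfolding p(2) by (auto simp: base_point_def shift_def coord_vec_nth)
  show False
    by (rule no_equivalence[OF card U(1) s(1) inj D p(1)]) (simp_all add: n)
qed

end

theorem proposition7p5:
  assumes "CARD('n::finite) \<ge> 9"
  shows "\<not> weakly_determined (goursat :: (real^'n, 'n) manifold \<Rightarrow> (real^'n, 'n) distr \<Rightarrow> bool) \<and>
    (\<exists>(M :: (real^'n, 'n) manifold) D (M' :: (real^'n, 'n) manifold) D' U U' \<phi> p p'.
       goursat M D \<and> goursat M' D' \<and>
       local_diffeo M M' U U' \<phi> \<and> p \<in> U \<and> \<phi> p = p' \<and>
       transforms_abnormal_curves M D M' D' U U' \<phi> \<and>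
       \<not> locally_equivalent M D p M' D' p')"
proof -
  have "base_point \<in> (half_space :: (real^'n) set)"
    using assms by (simp add: base_point_def half_space_def coord_vec_nth)
  note facts = goursat_jet_distr[OF assms] local_diffeo_shift[OF assms, of 1] this
    transforms_abnormal_curves_shift[OF assms, of 1] not_locally_equivalent[OF assms]
  show ?thesis
  proof
    show "\<not> weakly_determined (goursat :: (real^'n, 'n) manifold \<Rightarrow> (real^'n, 'n) distr \<Rightarrow> bool)"
      unfolding weakly_determined_def using facts by blast
    show "\<exists>(M :: (real^'n, 'n) manifold) D (M' :: (real^'n, 'n) manifold) D' U U' \<phi> p p'.
       goursat M D \<and> goursat M' D' \<and>
       local_diffeo M M' U U' \<phi> \<and> p \<in> U \<and> \<phi> p = p' \<and>
       transforms_abnormal_curves M D M' D' U U' \<phi> \<and>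
       \<not> locally_equivalent M D p M' D' p'"
      using facts by blast
  qed
qed

end
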